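(* The volume conjecture holds true for all torus knots, i.e. for all mutually prime positive integers $m,p$, with $L$ the $(m,p)$ torus knot, $$\lim_{k\to\infty}k^{-1}\log\bigl|\langle L\rangle_{k}\bigr|=0,$$ where $k$ runs over positive integers.
   Context: Here $i=\sqrt{-1}$. $L$ is the $(m,p)$ torus knot obtained as the $(m,p)$ cable about the unknot $O$ with zero framing. For a positive integer $k$ (the color, the dimension of an $SU(2)_q$-module, $q=e^h$), the colored Jones invariant of $O$ is $J_{O,k}(h)=\sinh(kh/2)/\sinh(h/2)$, and the colored Jones invariant $J_{L,k}(h)$ of $L$ is given by the explicit formula $$2\sinh(kh/2)\,\frac{J_{L,k}(h)}{J_{O,k}(h)}=\sum_{\epsilon=\pm1}\ \sum_{r=-(k-1)/2}^{(k-1)/2}\epsilon\, e^{hmpr^2+hr(m+\epsilon p)+\epsilon h/2},$$ where $r$ runs from $-(k-1)/2$ to $(k-1)/2$ in steps of $1$. The hyperbolic specification is $$\langle L\rangle_{k}=\lim_{h\to 2\pi i/k}\frac{J_{L,k}(h)}{J_{O,k}(h)}.$$ The volume conjecture states that this specification of the colored Jones invariant gives, in the limit $k\to\infty$, the simplicial volume (Gromov norm) of the knot; for torus knots it is the displayed statement that the limit is $0$. *)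

theory Defs
  imports Complex_Main
begin

definition colored_jones_unknot :: "nat \<Rightarrow> complex \<Rightarrow> complex" where
  "colored_jones_unknot k h = sinh (of_nat k * h / 2) / sinh (h / 2)"

text \<open>
  The sum over \<open>\<epsilon> = \<plusminus>1\<close> and \<open>r = -(k-1)/2, -(k-1)/2 + 1, \<dots>, (k-1)/2\<close>; the (possibly half-integral)
  \<open>r\<close> is parametrised as \<open>r = j - (k-1)/2\<close> with \<open>0 \<le> j < k\<close>.
\<close>

definition torus_knot_sum :: "nat \<Rightarrow> nat \<Rightarrow> nat \<Rightarrow> complex \<Rightarrow> complex" where
  "torus_knot_sum m p k h =
     (\<Sum>\<epsilon>\<in>{1, -1}. \<Sum>j<k.
        let r = of_nat j - (of_nat k - 1) / 2
        in \<epsilon> * exp (h * of_nat m * of_nat p * r ^ 2 + h * r * (of_nat m + \<epsilon> * of_nat p) + \<epsilon> * h / 2))"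

text \<open>
  The colored Jones invariant of the \<open>(m,p)\<close> torus knot (zero framing), i.e. the solution \<open>J\<close> of
  \<open>2 sinh(kh/2) J / J\<^sub>O = torus_knot_sum m p k h\<close>, with \<open>J\<^sub>O\<close> the invariant of the unknot.
  At the isolated zeros of \<open>sinh(kh/2)\<close> the quotients below take the conventional value 0
  (division by zero) and not the value of the analytic continuation; only punctured
  limits at such points are used.
\<close>

definition colored_jones_torus :: "nat \<Rightarrow> nat \<Rightarrow> nat \<Rightarrow> complex \<Rightarrow> complex" where
  "colored_jones_torus m p k h =
     colored_jones_unknot k h * torus_knot_sum m p k h / (2 * sinh (of_nat k * h / 2))"

definition jones_ratio :: "nat \<Rightarrow> nat \<Rightarrow> nat \<Rightarrow> complex \<Rightarrow> complex" where
  "jones_ratio m p k h = colored_jones_torus m p k h / colored_jones_unknot k h"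

definition spec_point :: "nat \<Rightarrow> complex" where
  "spec_point k = 2 * of_real pi * \<i> / of_nat k"

text \<open>\<open>Lim\<close> is unspecified when the limit does not exist, so existence has to be stated separately.\<close>

definition hyperbolic_spec :: "nat \<Rightarrow> nat \<Rightarrow> nat \<Rightarrow> complex" where
  "hyperbolic_spec m p k = Lim (at (spec_point k)) (jones_ratio m p k)"

end

theory Submission
  imports Defs
    "HOL-Probability.Sinc_Integral"
    "HOL-Complex_Analysis.Residue_Theorem"
    "HOL-Real_Asymp.Real_Asymp"
begin

text \<open>
  Write \<open>a = m p\<close> and \<open>h\<^sub>0 = 2 \<pi> \<i> / k\<close>.  Completing the square turns the sum defining the torus knot
  invariant into \<open>\<Sum> \<epsilon> exp (h (a x\<^sup>2 - \<mu>))\<close> over the nodes \<open>x = r + 1/(2p) + \<epsilon>/(2m)\<close>.  It vanishes at \<open>h\<^sub>0\<close>, and so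
  does \<open>2 sinh (k h / 2)\<close>, with derivative \<open>- k\<close>; hence the limit exists and has modulus \<open>a / k\<close> times
  the modulus of the Gauss sum \<open>P = \<Sum> \<epsilon> x\<^sup>2 exp (2 \<pi> \<i> a x\<^sup>2 / k)\<close>.

  The size of \<open>P\<close> is found as follows.  Each term is a moment of a complex
  Gaussian along the line \<open>\<omega> \<real>\<close> with \<open>\<omega> = exp (- \<pi> \<i> / 4)\<close>, on which \<open>exp (- \<i> \<kappa> s\<^sup>2)\<close> decays
  (\<open>\<kappa> = \<pi> a k / 2\<close>).  Under the integral the sum over \<open>r\<close> is geometric, and what
  remains is the integral of \<open>s\<^sup>2 exp (\<i> \<kappa> (2 s - s\<^sup>2)) K(s)\<close> with the odd kernel
  \<open>K(s) = sin (\<pi> m s) sin (\<pi> p s) / sin (\<pi> a s)\<close>.  The saddle point of the exponential is \<open>s = 1\<close>; moving the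
  line there crosses the poles \<open>j / a\<close>, \<open>0 < j < a\<close>.  On the new line \<open>K(1 + s) = - K(s)\<close> and
  parity leave only the linear part of \<open>(1 + s)\<^sup>2\<close>.  The result is, up to factors
  of modulus 1 and with \<open>\<rho> = sqrt \<kappa>\<close>,
  \<open>(2 / (\<pi> sqrt \<pi>)) (\<rho>\<^sup>3 M(\<kappa>) + \<rho>\<^sup>3 S(k) / a)\<close>
  for the value of the specification (lemma \<open>norm_hyperbolic_spec\<close>), where \<open>S(k)\<close> is the finite sum of
  residues and \<open>M(\<kappa>)\<close> is the integral of \<open>t exp (- \<kappa> t\<^sup>2) K(\<omega> t)\<close>.

  Two facts finish the argument.  Since \<open>K(s)\<close> is asymptotic to \<open>\<pi> s\<close> at \<open>0\<close>, dominated convergence gives a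
  nonzero limit for \<open>\<rho>\<^sup>3 M(\<kappa>)\<close>.  And \<open>S\<close> is periodic in \<open>k\<close>, so it takes finitely many values: either
  \<open>S(k) = 0\<close> and the first term keeps the modulus near 1, or \<open>S(k)\<close> is bounded away from 0 and the second
  term, of order \<open>k\<^bsup>3/2\<^esup>\<close>, dominates.  In both cases the modulus eventually lies between \<open>1/2\<close> and a
  polynomial in \<open>k\<close>, so its logarithm is \<open>o(k)\<close>.

  The vanishing of the sum at \<open>h\<^sub>0\<close> comes from the same computation with weight \<open>1\<close> in place
  of \<open>s\<^sup>2\<close>: the integral at the saddle point is odd, and the residue sum is reversed in sign by \<open>j \<mapsto> u j\<close> for a
  residue \<open>u\<close> with \<open>u \<equiv> 1\<close> modulo \<open>2 p\<close> and \<open>u \<equiv> - 1\<close> modulo \<open>2 m\<close>, which exists because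
  \<open>m\<close> and \<open>p\<close> are coprime.
\<close>

section \<open>Shifting a line of integration across poles\<close>

lemma integrable_exp_neg_abs: "integrable lborel (\<lambda>x::real. exp (-\<bar>x\<bar>))"
proof (rule Bochner_Integration.integrable_bound)
  have "set_integrable lborel UNIV (\<lambda>x::real. inverse (1 + x^2))"
    using integrable_inverse_1_plus_square by simp
  then have "integrable lborel (\<lambda>x::real. inverse (1 + x^2))"
    by (simp add: set_integrable_def)
  then show "integrable lborel (\<lambda>x::real. 2 * inverse (1 + x^2))" by simp
  have "exp (-\<bar>x\<bar>) \<le> 2 * inverse (1 + x^2)" for x :: real
  proof -
    have "1 + \<bar>x\<bar> + \<bar>x\<bar>^2/2 \<le> exp \<bar>x\<bar>"
      using exp_lower_Taylor_quadratic[of "\<bar>x\<bar>"] by simp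
    then have *: "(1 + x^2) / 2 \<le> exp \<bar>x\<bar>" by simp
    have "inverse (exp \<bar>x\<bar>) \<le> inverse ((1 + x^2) / 2)"
      by (rule le_imp_inverse_le[OF *]) (simp add: add_pos_nonneg)
    then show ?thesis by (simp add: exp_minus field_simps)
  qed
  then show "AE x in lborel. norm (exp (-\<bar>x\<bar>)) \<le> norm (2 * inverse (1 + x^2) :: real)"
    by auto
qed simp

text \<open>
  Integrands below are controlled only for large \<open>\<bar>x\<bar>\<close>, because the torus kernel has poles near the
  line; on the remaining compact interval continuity gives the bound.
\<close>

lemma integrable_exp_decay:
  fixes g :: "real \<Rightarrow> complex"
  assumes cont: "continuous_on UNIV g"
    and decay: "\<And>x. \<bar>x\<bar> \<ge> R \<Longrightarrow> norm (g x) \<le> B * exp (-\<bar>x\<bar>)"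
  shows "integrable lborel g"
proof -
  have "compact (g ` {-\<bar>R\<bar>..\<bar>R\<bar>})"
    by (intro compact_continuous_image continuous_on_subset[OF cont]) auto
  then obtain C where C: "\<And>x. x \<in> {-\<bar>R\<bar>..\<bar>R\<bar>} \<Longrightarrow> norm (g x) \<le> C"
    by (meson compact_imp_bounded bounded_iff imageI)
  have C0: "0 \<le> C" using C[of 0] norm_ge_zero[of "g 0"] by (smt (verit) atLeastAtMost_iff abs_ge_zero)
  define D where "D = max \<bar>B\<bar> (C * exp \<bar>R\<bar>)"
  have bound: "norm (g x) \<le> D * exp (-\<bar>x\<bar>)" for x
  proof (cases "\<bar>x\<bar> \<ge> R")
    case True
    have "B * exp (-\<bar>x\<bar>) \<le> D * exp (-\<bar>x\<bar>)"
      by (intro mult_right_mono) (auto simp: D_def)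
    then show ?thesis using decay[OF True] by linarith
  next
    case False
    then have "norm (g x) \<le> C" by (intro C) auto
    also have "C \<le> C * exp (\<bar>R\<bar> - \<bar>x\<bar>)"
      using False C0 mult_left_mono[of 1 "exp (\<bar>R\<bar> - \<bar>x\<bar>)" C] by simp
    also have "\<dots> = C * exp \<bar>R\<bar> * exp (-\<bar>x\<bar>)" by (simp add: exp_diff exp_minus field_simps)
    also have "\<dots> \<le> D * exp (-\<bar>x\<bar>)" by (intro mult_right_mono) (auto simp: D_def)
    finally show ?thesis .
  qed
  show ?thesis
  proof (rule Bochner_Integration.integrable_bound)
    show "integrable lborel (\<lambda>x::real. D * exp (-\<bar>x\<bar>))"
      using integrable_exp_neg_abs by simp
    show "g \<in> borel_measurable lborel"
      using borel_measurable_continuous_onI[OF cont] by simp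
    show "AE x in lborel. norm (g x) \<le> norm (D * exp (-\<bar>x\<bar>))"
      using order_trans[OF bound abs_ge_self] by (intro AE_I2) simp
  qed
qed

lemma tendsto_integral_symmetric_intervals:
  fixes g :: "real \<Rightarrow> complex"
  assumes cont: "continuous_on UNIV g" and int: "integrable lborel g"
  shows "(\<lambda>n. integral {-real n..real n} g) \<longlonglongrightarrow> integral\<^sup>L lborel g"
proof -
  have "(\<lambda>n. \<integral>x. indicator {-real n..real n} x *\<^sub>R g x \<partial>lborel) \<longlonglongrightarrow> integral\<^sup>L lborel g"
  proof (rule integral_dominated_convergence)
    show "integrable lborel (\<lambda>x. norm (g x))" using int by simp
    show "AE x in lborel. (\<lambda>n. indicator {-real n..real n} x *\<^sub>R g x) \<longlonglongrightarrow> g x"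
    proof (intro AE_I2 tendsto_eventually)
      fix x :: real
      obtain N :: nat where "\<bar>x\<bar> \<le> real N" using real_arch_simple by blast
      then have "-real n \<le> x \<and> x \<le> real n" if "n \<ge> N" for n
        using of_nat_mono[OF that, where ?'a=real] by linarith
      then show "\<forall>\<^sub>F n in sequentially. indicator {-real n..real n} x *\<^sub>R g x = g x"
        by (intro eventually_sequentiallyI[of N]) (auto simp: indicator_def)
    qed
  qed (use int borel_measurable_integrable[OF int] in \<open>auto simp: indicator_def\<close>)
  moreover have "(\<integral>x. indicator {-real n..real n} x *\<^sub>R g x \<partial>lborel) = integral {-real n..real n} g" for n
  proof -
    have "set_integrable lborel {-real n..real n} g"
      by (rule borel_integrable_atLeastAtMost') (rule continuous_on_subset[OF cont], simp)
    from set_borel_integral_eq_integral(2)[OF this] show ?thesis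
      by (simp add: set_lebesgue_integral_def)
  qed
  ultimately show ?thesis by simp
qed

lemma contour_integral_linepath_same_Im:
  assumes "Im z = c" "Im z' = c" "Re z = a" "Re z' = b" "a < b"
  shows   "contour_integral (linepath z z') f = integral {a..b} (\<lambda>x. f (of_real x + \<i> * of_real c))"
proof -
  have z: "z = of_real a + \<i> * of_real c" "z' = of_real b + \<i> * of_real c"
    using assms by (auto simp: complex_eq_iff)
  have "contour_integral (linepath z z') f
      = contour_integral (linepath (of_real a) (of_real b)) (\<lambda>w. f (w + \<i> * of_real c))"
    unfolding contour_integral_integral
    by (simp add: z linepath_def algebra_simps)
  also have "\<dots> = integral {a..b} (\<lambda>x. f (of_real x + \<i> * of_real c))"
    using assms by (subst contour_integral_linepath_Reals_eq) auto
  finally show ?thesis .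
qed

text \<open>
  The residue theorem for the rectangles with vertical sides at real parts \<open>\<plusminus> n\<close>: for large \<open>n\<close> every pole lies
  inside, and the decay assumption kills the vertical sides in the limit.
\<close>

lemma integral_horizontal_shift:
  fixes F :: "complex \<Rightarrow> complex" and y R B :: real
  assumes y: "y > 0" and U: "open U" "connected U" "{z. 0 \<le> Im z \<and> Im z \<le> y} \<subseteq> U"
    and P: "finite P" "P \<subseteq> {z. 0 < Im z \<and> Im z < y}"
    and hol: "F holomorphic_on U - P"
    and decay: "\<And>z. 0 \<le> Im z \<Longrightarrow> Im z \<le> y \<Longrightarrow> \<bar>Re z\<bar> \<ge> R \<Longrightarrow> norm (F z) \<le> B * exp (-\<bar>Re z\<bar>)"
  shows "integrable lborel (\<lambda>t. F (of_real t))" (is ?int0)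
    and "integrable lborel (\<lambda>t. F (of_real t + \<i> * of_real y))" (is ?inty)
    and "(\<integral>t. F (of_real t) \<partial>lborel) - (\<integral>t. F (of_real t + \<i> * of_real y) \<partial>lborel)
           = 2 * pi * \<i> * (\<Sum>w\<in>P. residue F w)"
proof -
  have contF: "continuous_on (U - P) F" using hol by (rule holomorphic_on_imp_continuous_on)
  have c0: "continuous_on UNIV (\<lambda>t. F (of_real t))"
    by (rule continuous_on_compose2[OF contF]) (use y U P in \<open>auto intro!: continuous_intros\<close>)
  have cy: "continuous_on UNIV (\<lambda>t. F (of_real t + \<i> * of_real y))"
    by (rule continuous_on_compose2[OF contF]) (use y U P in \<open>auto intro!: continuous_intros\<close>)
  show i0: ?int0
    by (rule integrable_exp_decay[OF c0, of R B]) (use decay[of "of_real _"] y in auto)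
  show iy: ?inty
    by (rule integrable_exp_decay[OF cy, of R B]) (use decay[of "of_real _ + \<i> * of_real y"] y in auto)
  define L where "L n = integral {-real n..real n} (\<lambda>t. F (of_real t))" for n
  define T where "T n = integral {-real n..real n} (\<lambda>t. F (of_real t + \<i> * of_real y))" for n
  define V where "V n = integral {0..y} (\<lambda>t. F (Complex (real n) t))" for n
  define W where "W n = integral {0..y} (\<lambda>t. F (Complex (-real n) t))" for n
  have L: "L \<longlonglongrightarrow> (\<integral>t. F (of_real t) \<partial>lborel)"
    unfolding L_def by (rule tendsto_integral_symmetric_intervals[OF c0 i0])
  have T: "T \<longlonglongrightarrow> (\<integral>t. F (of_real t + \<i> * of_real y) \<partial>lborel)"
    unfolding T_def by (rule tendsto_integral_symmetric_intervals[OF cy iy])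
  have vert: "(\<lambda>n. integral {0..y} (\<lambda>t. F (Complex (s * real n) t))) \<longlonglongrightarrow> 0" if s: "\<bar>s\<bar> = 1" for s
  proof (rule Lim_null_comparison)
    obtain M :: nat where M: "real M \<ge> max R (Max (insert 0 ((\<lambda>w. \<bar>Re w\<bar>) ` P)) + 1)" using real_arch_simple by blast
    have "norm (integral {0..y} (\<lambda>t. F (Complex (s * real n) t))) \<le> \<bar>B\<bar> * exp (-real n) * (y - 0)" if n: "n \<ge> M" for n
    proof (rule integral_bound)
      have nM: "real n \<ge> real M" using n by simp
      show "continuous_on {0..y} (\<lambda>t. F (Complex (s * real n) t))"
      proof (rule continuous_on_compose2[OF contF])
        show "continuous_on {0..y} (Complex (s * real n))"
          unfolding Complex_eq by (intro continuous_intros)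
        have "Complex (s * real n) t \<notin> P" for t
        proof
          assume "Complex (s * real n) t \<in> P"
          then have "\<bar>Re (Complex (s * real n) t)\<bar> \<le> Max (insert 0 ((\<lambda>w. \<bar>Re w\<bar>) ` P))"
            by (intro Max_ge finite.insertI finite_imageI P(1)) blast
          then show False using M nM s by (simp add: abs_mult)
        qed
        then show "Complex (s * real n) ` {0..y} \<subseteq> U - P" using U(3) by auto
      qed
      show "norm (F (Complex (s * real n) t)) \<le> \<bar>B\<bar> * exp (-real n)" if "t \<in> {0..y}" for t
      proof -
        have "norm (F (Complex (s * real n) t)) \<le> B * exp (-\<bar>s * real n\<bar>)"
          using decay[of "Complex (s * real n) t"] that M nM s by (simp add: abs_mult)
        also have "\<dots> \<le> \<bar>B\<bar> * exp (-real n)" using s by (simp add: abs_mult mult_right_mono)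
        finally show ?thesis .
      qed
    qed (use y in simp)
    then show "\<forall>\<^sub>F n in sequentially. norm (integral {0..y} (\<lambda>t. F (Complex (s * real n) t))) \<le> \<bar>B\<bar> * exp (-real n) * (y - 0)"
      by (rule eventually_sequentiallyI)
    show "(\<lambda>n. \<bar>B\<bar> * exp (-real n) * (y - 0)) \<longlonglongrightarrow> 0" by real_asymp
  qed
  have V: "V \<longlonglongrightarrow> 0" unfolding V_def using vert[of 1] by simp
  have W: "W \<longlonglongrightarrow> 0" unfolding W_def using vert[of "-1"] by simp
  obtain M :: nat where M: "real M \<ge> Max (insert 0 ((\<lambda>w. \<bar>Re w\<bar>) ` P)) + 1" using real_arch_simple by blast
  have key: "L n + \<i> * V n - T n - \<i> * W n = 2 * pi * \<i> * (\<Sum>w\<in>P. residue F w)" if n: "n \<ge> M" for n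
  proof -
    have Pn: "\<bar>Re w\<bar> < real n" if "w \<in> P" for w
    proof -
      have "\<bar>Re w\<bar> \<le> Max (insert 0 ((\<lambda>w. \<bar>Re w\<bar>) ` P))" using that P(1) by (intro Max_ge) auto
      then show ?thesis using M n by (meson dual_order.strict_trans1 less_add_one of_nat_mono order_le_less_trans)
    qed
    have "Max (insert 0 ((\<lambda>w. \<bar>Re w\<bar>) ` P)) \<ge> 0" using P(1) by (intro Max_ge) auto
    then have n0: "real n > 0" using M n by (smt (verit) of_nat_mono)
    define c d where "c = Complex (-real n) 0" and "d = Complex (real n) y"
    have box: "cbox c d \<subseteq> U" using U(3) by (auto simp: cbox_def Basis_complex_def c_def d_def)
    have Pbox: "P \<subseteq> box c d"
      using P(2) Pn by (force simp: box_def Basis_complex_def c_def d_def abs_less_iff)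
    have img: "path_image (rectpath c d) \<subseteq> cbox c d - box c d"
      by (subst path_image_rectpath_cbox_minus_box) (use y n0 in \<open>auto simp: c_def d_def\<close>)
    have "contour_integral (rectpath c d) F = 2 * pi * \<i> * (\<Sum>w\<in>P. winding_number (rectpath c d) w * residue F w)"
    proof (rule Residue_theorem[OF U(1,2) P(1) hol])
      show "path_image (rectpath c d) \<subseteq> U - P" using img box Pbox by auto
      show "\<forall>z. z \<notin> U \<longrightarrow> winding_number (rectpath c d) z = 0"
      proof (intro allI impI)
        fix z assume "z \<notin> U"
        then have "z \<notin> cbox c d" using box by auto
        then show "winding_number (rectpath c d) z = 0"
          by (intro winding_number_rectpath_outside) (use y n0 in \<open>auto simp: c_def d_def\<close>)
      qed
    qed auto
    also have "(\<Sum>w\<in>P. winding_number (rectpath c d) w * residue F w) = (\<Sum>w\<in>P. residue F w)"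
      by (intro sum.cong refl) (use Pbox in \<open>auto simp: winding_number_rectpath\<close>)
    finally have res: "contour_integral (rectpath c d) F = 2 * pi * \<i> * (\<Sum>w\<in>P. residue F w)" .
    have segs: "path_image (rectpath c d) = closed_segment c (Complex (real n) 0)
        \<union> (closed_segment (Complex (real n) 0) d \<union> (closed_segment d (Complex (-real n) y)
        \<union> closed_segment (Complex (-real n) y) c))"
      by (simp add: rectpath_def Let_def path_image_join c_def d_def)
    have seg_int: "F contour_integrable_on linepath u v"
      if "closed_segment u v \<subseteq> path_image (rectpath c d)" for u v
      by (rule contour_integrable_continuous_linepath, rule continuous_on_subset[OF contF])
         (use that img box Pbox in blast)
    have i: "F contour_integrable_on linepath c (Complex (real n) 0)"
            "F contour_integrable_on linepath (Complex (real n) 0) d"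
            "F contour_integrable_on linepath d (Complex (-real n) y)"
            "F contour_integrable_on linepath (Complex (-real n) y) c"
      by (rule seg_int, unfold segs, blast)+
    have "contour_integral (rectpath c d) F =
        contour_integral (linepath c (Complex (real n) 0)) F + (contour_integral (linepath (Complex (real n) 0) d) F
        + (contour_integral (linepath d (Complex (-real n) y)) F + contour_integral (linepath (Complex (-real n) y) c) F))"
      using i by (simp add: rectpath_def Let_def c_def d_def)
    also have "contour_integral (linepath d (Complex (-real n) y)) F
        = - contour_integral (linepath (Complex (-real n) y) d) F"
      using segs img box Pbox closed_segment_commute[of d "Complex (-real n) y"]
      by (intro contour_integral_reverse_linepath continuous_on_subset[OF contF]) blast
    also have "contour_integral (linepath (Complex (-real n) y) c) F
        = - contour_integral (linepath c (Complex (-real n) y)) F"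
      using segs img box Pbox
      by (intro contour_integral_reverse_linepath continuous_on_subset[OF contF]) blast
    also have "contour_integral (linepath c (Complex (real n) 0)) F = L n"
      unfolding L_def c_def
      by (subst contour_integral_linepath_same_Im[where c=0 and a="-real n" and b="real n"]) (use n0 in auto)
    also have "contour_integral (linepath (Complex (-real n) y) d) F = T n"
      unfolding T_def d_def
      by (subst contour_integral_linepath_same_Im[where c=y and a="-real n" and b="real n"]) (use n0 in auto)
    also have "contour_integral (linepath (Complex (real n) 0) d) F = \<i> * V n"
      unfolding V_def d_def
      by (subst contour_integral_linepath_same_Re[where c="real n" and a=0 and b=y]) (use y in auto)
    also have "contour_integral (linepath c (Complex (-real n) y)) F = \<i> * W n"
      unfolding W_def c_def
      by (subst contour_integral_linepath_same_Re[where c="-real n" and a=0 and b=y]) (use y in auto)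
    finally show ?thesis using res by (simp add: algebra_simps)
  qed
  have "(\<lambda>n. L n + \<i> * V n - T n - \<i> * W n) \<longlonglongrightarrow>
     (\<integral>t. F (of_real t) \<partial>lborel) + \<i> * 0 - (\<integral>t. F (of_real t + \<i> * of_real y) \<partial>lborel) - \<i> * 0"
    by (intro tendsto_intros L T V W)
  moreover have "(\<lambda>n. L n + \<i> * V n - T n - \<i> * W n) \<longlonglongrightarrow> 2 * pi * \<i> * (\<Sum>w\<in>P. residue F w)"
    by (rule tendsto_eventually) (rule eventually_sequentiallyI[of M], rule key)
  ultimately show "(\<integral>t. F (of_real t) \<partial>lborel) - (\<integral>t. F (of_real t + \<i> * of_real y) \<partial>lborel)
           = 2 * pi * \<i> * (\<Sum>w\<in>P. residue F w)"
    using LIMSEQ_unique by fastforce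
qed

section \<open>Complex Gaussian integrals\<close>

lemma has_bochner_integral_gaussian_moment:
  fixes \<kappa> :: real
  assumes \<kappa>: "\<kappa> > 0"
  shows "has_bochner_integral lborel (\<lambda>t. exp (-\<kappa> * t\<^sup>2)) (sqrt (pi / \<kappa>))"
    and "has_bochner_integral lborel (\<lambda>t. t * exp (-\<kappa> * t\<^sup>2)) 0"
    and "has_bochner_integral lborel (\<lambda>t. t\<^sup>2 * exp (-\<kappa> * t\<^sup>2)) (sqrt (pi / \<kappa>) / (2 * \<kappa>))"
proof -
  define \<sigma> where "\<sigma> = 1 / sqrt (2 * \<kappa>)"
  have \<sigma>: "\<sigma> > 0" and \<sigma>2: "\<sigma>\<^sup>2 = 1 / (2 * \<kappa>)" using \<kappa> by (auto simp: \<sigma>_def power_divide)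
  have dens: "exp (-\<kappa> * t\<^sup>2) = sqrt (pi / \<kappa>) * normal_density 0 \<sigma> t" for t
  proof -
    have "sqrt (2 * pi * \<sigma>\<^sup>2) = sqrt (pi / \<kappa>)" "sqrt (pi / \<kappa>) > 0"
      using \<kappa> by (simp_all add: \<sigma>2)
    then show ?thesis using \<kappa> by (simp add: normal_density_def \<sigma>2 field_simps)
  qed
  show "has_bochner_integral lborel (\<lambda>t. exp (-\<kappa> * t\<^sup>2)) (sqrt (pi / \<kappa>))"
    using has_bochner_integral_mult_right[OF normal_moment_even[OF \<sigma>, of 0 0], of "sqrt (pi / \<kappa>)"]
    unfolding dens by simp
  show "has_bochner_integral lborel (\<lambda>t. t * exp (-\<kappa> * t\<^sup>2)) 0"
    using has_bochner_integral_mult_right[OF normal_moment_odd[OF \<sigma>, of 0 0], of "sqrt (pi / \<kappa>)"]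
    unfolding dens by (simp add: mult_ac)
  have "sqrt (pi / \<kappa>) * (fact (2 * 1) / ((2 / \<sigma>\<^sup>2) ^ 1 * fact 1)) = sqrt (pi / \<kappa>) / (2 * \<kappa>)"
    by (simp add: \<sigma>2)
  then show "has_bochner_integral lborel (\<lambda>t. t\<^sup>2 * exp (-\<kappa> * t\<^sup>2)) (sqrt (pi / \<kappa>) / (2 * \<kappa>))"
    using has_bochner_integral_mult_right[OF normal_moment_even[OF \<sigma>, of 0 1], of "sqrt (pi / \<kappa>)"]
    unfolding dens by (simp add: mult_ac)
qed

lemma neg_quadratic_le_neg_abs:
  fixes \<kappa> A u :: real
  assumes "\<kappa> > 0"
  shows "-\<kappa> * u\<^sup>2 + A * \<bar>u\<bar> \<le> (A + 1)\<^sup>2 / (4 * \<kappa>) - \<bar>u\<bar>"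
proof -
  have "0 \<le> (2 * \<kappa> * \<bar>u\<bar> - (A + 1))\<^sup>2 / (4 * \<kappa>)" using assms by simp
  also have "\<dots> = \<kappa> * u\<^sup>2 - (A + 1) * \<bar>u\<bar> + (A + 1)\<^sup>2 / (4 * \<kappa>)"
    using assms by (simp add: power2_diff power_mult_distrib field_simps) (simp add: power2_eq_square)
  finally show ?thesis by (simp add: algebra_simps)
qed

lemma power_le_exp_mult:
  fixes x :: real
  assumes "0 \<le> x"
  shows "x ^ n \<le> exp (n * x)"
proof -
  have "x ^ n \<le> exp x ^ n"
    using assms exp_ge_add_one_self[of x] by (intro power_mono) linarith+
  then show ?thesis by (simp add: exp_of_nat_mult)
qed

text \<open>
  The extra displacement \<open>e\<close> lets the same statement serve for upward and downward shifts: below, a Gaussian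
  centred in the lower half plane is obtained by shifting one with a real centre upwards.
\<close>

lemma gaussian_shift_upper:
  fixes y \<kappa> :: real and d e :: complex and n :: nat
  assumes \<kappa>: "\<kappa> > 0" and y: "y \<ge> 0"
  defines "F \<equiv> \<lambda>z::complex. (z + e) ^ n * exp (- of_real \<kappa> * (z - d)\<^sup>2)"
  shows "integrable lborel (\<lambda>t. F (of_real t))"
    and "integrable lborel (\<lambda>t. F (of_real t + \<i> * of_real y))"
    and "(\<integral>t. F (of_real t) \<partial>lborel) = (\<integral>t. F (of_real t + \<i> * of_real y) \<partial>lborel)"
proof -
  define A where "A = n + 2 * \<kappa> * \<bar>Re d\<bar>"
  define B where "B = exp (n * (y + 1 + norm e) + \<kappa> * (y + 1 + \<bar>Im d\<bar>)\<^sup>2 + (A + 1)\<^sup>2 / (4 * \<kappa>))"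
  have decay: "norm (F z) \<le> B * exp (-\<bar>Re z\<bar>)" if z: "0 \<le> Im z" "Im z \<le> y + 1" for z
  proof -
    have "norm (z + e) \<le> \<bar>Re z\<bar> + (y + 1) + norm e"
      using norm_triangle_ineq[of z e] cmod_le[of z] z by linarith
    then have "norm ((z + e) ^ n) \<le> (\<bar>Re z\<bar> + (y + 1) + norm e) ^ n"
      by (simp add: norm_power power_mono)
    also have "\<dots> \<le> exp (n * (\<bar>Re z\<bar> + (y + 1) + norm e))"
      by (rule power_le_exp_mult) (use y in auto)
    finally have 1: "norm ((z + e) ^ n) \<le> exp (n * (\<bar>Re z\<bar> + (y + 1) + norm e))" .
    have "Re (- of_real \<kappa> * (z - d)\<^sup>2) = - \<kappa> * ((Re z - Re d)\<^sup>2 - (Im z - Im d)\<^sup>2)"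
      by (simp add: Re_power2)
    also have "\<dots> \<le> - \<kappa> * (Re z)\<^sup>2 + 2 * \<kappa> * \<bar>Re d\<bar> * \<bar>Re z\<bar> + \<kappa> * (y + 1 + \<bar>Im d\<bar>)\<^sup>2"
    proof -
      have "(Im z - Im d)\<^sup>2 \<le> (y + 1 + \<bar>Im d\<bar>)\<^sup>2" using z y by (intro abs_le_square_iff[THEN iffD1]) auto
      moreover have "Re z * Re d \<le> \<bar>Re d\<bar> * \<bar>Re z\<bar>" by (metis abs_ge_self abs_mult mult.commute)
      ultimately have "- ((Re z - Re d)\<^sup>2 - (Im z - Im d)\<^sup>2) \<le> - (Re z)\<^sup>2 + 2 * \<bar>Re d\<bar> * \<bar>Re z\<bar> + (y + 1 + \<bar>Im d\<bar>)\<^sup>2"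
        unfolding power2_diff[of "Re z" "Re d"] using zero_le_power2[of "Re d"] by linarith
      from mult_left_mono[OF this, of \<kappa>] show ?thesis using \<kappa> by (simp add: algebra_simps)
    qed
    finally have "norm (exp (- of_real \<kappa> * (z - d)\<^sup>2))
       \<le> exp (- \<kappa> * (Re z)\<^sup>2 + 2 * \<kappa> * \<bar>Re d\<bar> * \<bar>Re z\<bar> + \<kappa> * (y + 1 + \<bar>Im d\<bar>)\<^sup>2)"
      by (simp only: norm_exp_eq_Re exp_le_cancel_iff)
    from mult_mono[OF 1 this] have "norm (F z) \<le> exp (n * (\<bar>Re z\<bar> + (y + 1) + norm e)) *
        exp (- \<kappa> * (Re z)\<^sup>2 + 2 * \<kappa> * \<bar>Re d\<bar> * \<bar>Re z\<bar> + \<kappa> * (y + 1 + \<bar>Im d\<bar>)\<^sup>2)"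
      by (simp add: F_def norm_mult)
    also have "\<dots> = exp ((- \<kappa> * (Re z)\<^sup>2 + A * \<bar>Re z\<bar>) + n * (y + 1 + norm e) + \<kappa> * (y + 1 + \<bar>Im d\<bar>)\<^sup>2)"
      by (simp add: exp_add[symmetric] A_def algebra_simps)
    also have "\<dots> \<le> exp (((A + 1)\<^sup>2 / (4 * \<kappa>) - \<bar>Re z\<bar>) + n * (y + 1 + norm e) + \<kappa> * (y + 1 + \<bar>Im d\<bar>)\<^sup>2)"
      using neg_quadratic_le_neg_abs[OF \<kappa>, of "Re z" A] by simp
    also have "\<dots> = B * exp (-\<bar>Re z\<bar>)" by (simp add: B_def exp_add[symmetric] algebra_simps)
    finally show ?thesis .
  qed
  have hol: "F holomorphic_on UNIV - {}" unfolding F_def by (intro holomorphic_intros)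
  show "integrable lborel (\<lambda>t. F (of_real t))"
    by (rule integral_horizontal_shift(1)[of "y + 1" UNIV "{}" F 0 B]) (use y hol decay in auto)
  show "integrable lborel (\<lambda>t. F (of_real t + \<i> * of_real y))"
       "(\<integral>t. F (of_real t) \<partial>lborel) = (\<integral>t. F (of_real t + \<i> * of_real y) \<partial>lborel)"
    using integral_horizontal_shift(2,3)[of y UNIV "{}" F 0 B]
      integral_horizontal_shift(1)[of "y + 1" UNIV "{}" F 0 B] y hol decay
    by (cases "y = 0"; force)+
qed

lemma gaussian_shift:
  fixes d :: complex and \<kappa> :: real
  assumes \<kappa>: "\<kappa> > 0"
  shows "integrable lborel (\<lambda>t. of_real t ^ n * exp (- of_real \<kappa> * (of_real t - d)\<^sup>2))"
    and "(\<integral>t. of_real t ^ n * exp (- of_real \<kappa> * (of_real t - d)\<^sup>2) \<partial>lborel)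
       = (\<integral>t. (of_real t + d) ^ n * exp (- of_real (\<kappa> * t\<^sup>2)) \<partial>lborel)"
proof -
  define c y where "c = Re d" and "y = Im d"
  have d: "d = of_real c + \<i> * of_real y" by (simp add: c_def y_def complex_eq)
  have trans: "(\<integral>t. (of_real t + \<i> * of_real y) ^ n * exp (- of_real \<kappa> * (of_real t - of_real c)\<^sup>2) \<partial>lborel)
     = (\<integral>t. (of_real t + d) ^ n * exp (- of_real (\<kappa> * t\<^sup>2)) \<partial>lborel)"
    by (subst lborel_integral_real_affine[where c=1 and t=c]) (simp_all add: d algebra_simps)
  have "integrable lborel (\<lambda>t. of_real t ^ n * exp (- of_real \<kappa> * (of_real t - d)\<^sup>2)) \<and>
    (\<integral>t. of_real t ^ n * exp (- of_real \<kappa> * (of_real t - d)\<^sup>2) \<partial>lborel)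
     = (\<integral>t. (of_real t + \<i> * of_real y) ^ n * exp (- of_real \<kappa> * (of_real t - of_real c)\<^sup>2) \<partial>lborel)"
  proof (cases "y \<ge> 0")
    case True
    show ?thesis using gaussian_shift_upper[OF \<kappa> True, of 0 n d] by (simp add: d algebra_simps)
  next
    case False
    then have "- y \<ge> 0" by simp
    show ?thesis using gaussian_shift_upper[OF \<kappa> \<open>- y \<ge> 0\<close>, of "\<i> * of_real y" n "of_real c"]
      by (simp add: d algebra_simps)
  qed
  then show "integrable lborel (\<lambda>t. of_real t ^ n * exp (- of_real \<kappa> * (of_real t - d)\<^sup>2))"
    and "(\<integral>t. of_real t ^ n * exp (- of_real \<kappa> * (of_real t - d)\<^sup>2) \<partial>lborel)
       = (\<integral>t. (of_real t + d) ^ n * exp (- of_real (\<kappa> * t\<^sup>2)) \<partial>lborel)"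
    using trans by auto
qed

section \<open>The torus kernel\<close>

text \<open>
  At the zeros of the denominator the value is 0 by the convention for division.  This is the value of
  the continuous extension at the points \<open>0\<close> and \<open>1\<close>, through which the lines of integration pass.
\<close>

definition torus_kernel :: "nat \<Rightarrow> nat \<Rightarrow> complex \<Rightarrow> complex" where
  "torus_kernel m p s = sin (of_real (pi * m) * s) * sin (of_real (pi * p) * s) / sin (of_real (pi * real (m * p)) * s)"

text \<open>
  This keeps the denominator of the torus kernel away from 0 off the real axis, linearly in the distance.
\<close>

lemma norm_sin_ge_Im: "\<bar>Im z\<bar> / sqrt 2 \<le> norm (sin z)"
proof (rule power2_le_imp_le)
  define u where "u = 2 * \<bar>Im z\<bar>"
  have "1 + u + u\<^sup>2 / 2 \<le> exp u" by (rule exp_lower_Taylor_quadratic) (simp add: u_def)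
  moreover have "1 - u \<le> exp (-u)" using exp_ge_add_one_self[of "-u"] by simp
  ultimately have "2 + u\<^sup>2 / 2 \<le> exp u + exp (-u)" by linarith
  also have "\<dots> = exp (2 * Im z) + inverse (exp (2 * Im z))"
    by (cases "Im z \<ge> 0") (auto simp: u_def exp_minus)
  finally have "2 + u\<^sup>2 / 2 \<le> exp (2 * Im z) + inverse (exp (2 * Im z))" .
  moreover have "v / 4 \<le> (X - 2 * c) / 4" if "2 + v \<le> X" "c \<le> 1" for v c X :: real
    using that by simp
  ultimately have "u\<^sup>2 / 2 / 4 \<le> (exp (2 * Im z) + inverse (exp (2 * Im z)) - 2 * cos (2 * Re z)) / 4"
    using cos_le_one by blast
  also have "\<dots> = (norm (sin z))\<^sup>2" by (simp add: norm_sin_squared)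
  finally show "(\<bar>Im z\<bar> / sqrt 2)\<^sup>2 \<le> (norm (sin z))\<^sup>2" by (simp add: u_def power_divide power_mult_distrib)
qed simp

lemma norm_sin_le_mult_exp: "norm (sin z) \<le> norm z * exp (norm z)" for z :: complex
proof -
  have "norm (sin z - sin 0) \<le> exp (norm z) * norm (z - 0)"
  proof (rule field_differentiable_bound[of "cball 0 (norm z)" sin cos])
    show "norm (cos w) \<le> exp (norm z)" if "w \<in> cball 0 (norm z)" for w :: complex
    proof -
      have "norm (cos w) \<le> exp (norm w)" by (rule norm_cos_le)
      also have "\<dots> \<le> exp (norm z)" using that by simp
      finally show ?thesis .
    qed
  qed (auto intro!: derivative_eq_intros)
  then show ?thesis by (simp add: mult.commute)
qed

lemma sin_eq_0_iff_grid:
  fixes a :: real and s :: complex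
  assumes "a > 0"
  shows "sin (of_real (pi * a) * s) = 0 \<longleftrightarrow> (\<exists>j::int. s = of_real (of_int j / a))"
proof -
  have "of_real (pi * a) * s = of_real (of_int j * pi) \<longleftrightarrow> s = of_real (of_int j / a)" for j :: int
    using assms by (auto simp: field_simps)
  then show ?thesis by (simp only: sin_eq_0)
qed

lemma torus_kernel_minus: "torus_kernel m p (- s) = - torus_kernel m p s"
  by (simp add: torus_kernel_def)

lemma sin_add_of_nat_pi: "sin (of_nat n * of_real pi + z) = (-1) ^ n * sin z" for z :: complex
  by (induction n) (simp_all add: distrib_right add.assoc sin_add[of "of_real pi"])

text \<open>
  The sign is \<open>(-1)\<^bsup>m + p + m p\<^esup>\<close>, and the exponent is \<open>(m + 1) (p + 1) - 1\<close>, which is odd unless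
  \<open>m\<close> and \<open>p\<close> are both even.
\<close>

lemma torus_kernel_add_1:
  assumes "coprime m p"
  shows "torus_kernel m p (1 + s) = - torus_kernel m p s"
proof -
  have sh: "sin (of_real (pi * real n) * (1 + s)) = (-1) ^ n * sin (of_real (pi * real n) * s)" for n
  proof -
    have "of_real (pi * real n) * (1 + s) = of_nat n * of_real pi + of_real (pi * real n) * s"
      by (simp add: distrib_left)
    then show ?thesis by (simp only: sin_add_of_nat_pi)
  qed
  have "\<not> (even m \<and> even p)" using coprime_common_divisor[OF assms, of 2] by auto
  then show ?thesis
    unfolding torus_kernel_def sh
    by (cases "even m"; cases "even p") (simp_all only: even_mult_iff minus_one_power_iff if_True if_False simp_thms, simp_all)
qed

lemma tendsto_sin_mult_over_self: "((\<lambda>s. sin (c * s) / s) \<longlongrightarrow> c) (at 0)" for c :: complex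
proof -
  have "((\<lambda>s. sin (c * s)) has_field_derivative c) (at 0)"
    by (auto intro!: derivative_eq_intros)
  then show ?thesis by (simp add: has_field_derivative_iff)
qed

lemma tendsto_torus_kernel_over_self:
  assumes "m > 0" "p > 0"
  shows "((\<lambda>s. torus_kernel m p s / s) \<longlongrightarrow> of_real pi) (at 0)"
proof -
  have "((\<lambda>s::complex. (sin (of_real (pi * m) * s) / s) * (sin (of_real (pi * p) * s) / s) / (sin (of_real (pi * real (m * p)) * s) / s))
     \<longlongrightarrow> of_real (pi * m) * of_real (pi * p) / of_real (pi * real (m * p))) (at 0)"
    by (intro tendsto_mult tendsto_divide tendsto_sin_mult_over_self) (use assms in simp)
  moreover have "of_real (pi * m) * of_real (pi * p) / of_real (pi * real (m * p)) = (of_real pi :: complex)"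
    using assms by (simp add: field_simps)
  ultimately have "((\<lambda>s::complex. (sin (of_real (pi * m) * s) / s) * (sin (of_real (pi * p) * s) / s) / (sin (of_real (pi * real (m * p)) * s) / s))
     \<longlongrightarrow> of_real pi) (at 0)" by (simp only:)
  then show ?thesis
  proof (rule Lim_transform_eventually)
    have quot: "x / s * (y / s) / (z / s) = x * y / z / s" if "s \<noteq> 0" for x y z s :: complex
      using that by (cases "z = 0") (auto simp: divide_simps)
    show "\<forall>\<^sub>F s in at 0. sin (of_real (pi * m) * s) / s * (sin (of_real (pi * p) * s) / s)
        / (sin (of_real (pi * real (m * p)) * s) / s) = torus_kernel m p s / s"
      using eventually_neq_at_within unfolding torus_kernel_def
      by (rule eventually_mono) (rule quot)
  qed
qed

lemma isCont_torus_kernel_0: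
  assumes "m > 0" "p > 0"
  shows "isCont (torus_kernel m p) 0"
proof -
  have "((\<lambda>s. torus_kernel m p s / s * s) \<longlongrightarrow> of_real pi * 0) (at 0)"
    by (intro tendsto_mult tendsto_ident_at tendsto_torus_kernel_over_self assms)
  then have "(torus_kernel m p \<longlongrightarrow> 0) (at 0)"
    unfolding mult_zero_right
    by (rule Lim_transform_eventually) (simp add: eventually_at_filter)
  moreover have "torus_kernel m p 0 = 0" by (simp add: torus_kernel_def)
  ultimately show ?thesis by (simp add: isCont_def)
qed

lemma isCont_torus_kernel_1:
  assumes "m > 0" "p > 0" "coprime m p"
  shows "isCont (torus_kernel m p) 1"
proof -
  have "isCont (\<lambda>s. torus_kernel m p (s - 1)) 1"
    by (rule isCont_o2[where g = "torus_kernel m p"]) (simp_all add: isCont_torus_kernel_0 assms)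
  then have "isCont (\<lambda>s. - torus_kernel m p (s - 1)) 1" by (rule continuous_minus)
  moreover have eq: "torus_kernel m p = (\<lambda>s. - torus_kernel m p (s - 1))"
  proof
    show "torus_kernel m p s = - torus_kernel m p (s - 1)" for s
      using torus_kernel_add_1[OF assms(3), of "s - 1"] by simp
  qed
  ultimately show ?thesis by (subst eq)
qed

text \<open>
  The strip is bounded by lines of slope \<open>-1\<close>.  It contains exactly the zeros \<open>j / a\<close>, \<open>0 \<le> j \<le> a\<close>, of the
  denominator, and the two outermost are removable singularities.
\<close>

lemma holomorphic_torus_kernel:
  fixes a m p :: nat
  assumes "m > 0" "p > 0" "coprime m p" and a: "a = m * p"
  shows "torus_kernel m p holomorphic_on
     {s. - 1 / a < Re s + Im s \<and> Re s + Im s < 1 + 1 / a} - (\<lambda>j. of_real (j / a)) ` {1..<a}"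
proof -
  define U where "U = {s::complex. - 1 / a < Re s + Im s \<and> Re s + Im s < 1 + 1 / a}"
  define P where "P = (\<lambda>j. of_real (j / a) :: complex) ` {1..<a}"
  have a0: "a > 0" using assms by simp
  have "open U" unfolding U_def by (intro open_Collect_conj open_Collect_less continuous_intros)
  moreover have "finite P" by (simp add: P_def)
  ultimately have UP: "open (U - P)" by (intro open_Diff finite_imp_closed)
  have nz: "sin (of_real (pi * a) * s) \<noteq> 0" if s: "s \<in> U - P - {0, 1}" for s :: complex
  proof
    assume "sin (of_real (pi * a) * s) = 0"
    then obtain j :: int where j: "s = of_real (of_int j / a)"
      using sin_eq_0_iff_grid[of "real a" s] a0 by auto
    have sum: "Re s + Im s = of_int j / a" by (simp add: j)
    have "- 1 / a < of_int j / a" "of_int j / a < 1 + 1 / a"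
      using s unfolding sum[symmetric] U_def by auto
    then have "real_of_int (-1) < of_int j" "real_of_int j < of_int (int a + 1)" using a0 by (simp_all add: field_simps)
    then have "-1 < j" "j < int a + 1" by (simp_all only: of_int_less_iff)
    moreover have "j \<noteq> 0" using s by (auto simp: j)
    moreover have "j \<noteq> int a"
    proof
      assume "j = int a"
      then have "s = 1" using a0 by (simp add: j)
      then show False using s by simp
    qed
    ultimately have nj: "nat j \<in> {1..<a}" "real (nat j) = of_int j" by auto
    have "s \<in> P" unfolding P_def by (rule image_eqI[OF _ nj(1)]) (simp only: j nj(2))
    then show False using s by simp
  qed
  have h: "torus_kernel m p holomorphic_on U - P - {0, 1}"
    unfolding torus_kernel_def by (intro holomorphic_intros) (use nz a in blast)
  have op: "open (U - P - {0, 1})" by (rule open_Diff[OF UP]) simp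
  have "isCont (torus_kernel m p) s" if s: "s \<in> U - P" for s
  proof (cases "s \<in> {0, 1}")
    case True
    then show ?thesis using isCont_torus_kernel_0[OF assms(1,2)] isCont_torus_kernel_1[OF assms(1-3)] by auto
  next
    case False
    then have "s \<in> U - P - {0, 1}" using s by simp
    then show ?thesis
      using holomorphic_on_imp_continuous_on[OF h] continuous_on_eq_continuous_at[OF op] by blast
  qed
  then have "continuous_on (U - P) (torus_kernel m p)"
    by (intro continuous_at_imp_continuous_on ballI)
  from no_isolated_singularity[OF this h UP]
  show ?thesis unfolding U_def P_def by simp
qed

section \<open>Crossing the poles along slanted lines\<close>

text \<open>
  This is \<open>exp (- \<pi> \<i> / 4)\<close>.  Multiplication by it maps horizontal lines to lines of slope \<open>-1\<close>, on which
  \<open>exp (- \<i> \<kappa> s\<^sup>2)\<close> is a decaying Gaussian.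
\<close>

definition slant :: complex where "slant = Complex (1 / sqrt 2) (- (1 / sqrt 2))"

lemma slant_square: "slant\<^sup>2 = - \<i>"
  by (simp add: slant_def complex_eq_iff power2_eq_square)

lemma norm_slant [simp]: "norm slant = 1"
  by (simp add: slant_def cmod_def power_divide)

lemma slant_nonzero [simp]: "slant \<noteq> 0"
  by (metis norm_slant norm_zero zero_neq_one)

lemma Im_slant_mult: "Im (slant * z) = (Im z - Re z) / sqrt 2"
  by (simp add: slant_def field_simps)

lemma Re_add_Im_slant_mult: "Re (slant * z) + Im (slant * z) = sqrt 2 * Im z"
  by (simp add: slant_def field_simps)

text \<open>
  Raising the horizontal line by \<open>1 / sqrt 2\<close> moves its slanted image from the origin to the point 1, up to a
  translation along the line.
\<close>

lemma slant_mult_shift: "slant * (of_real t + \<i> * of_real (1 / sqrt 2)) = 1 + slant * of_real (t - 1 / sqrt 2)"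
  by (simp add: slant_def complex_eq_iff field_simps)

lemma norm_torus_kernel_le:
  assumes "m > 0" "p > 0" "Im s \<noteq> 0"
  shows "norm (torus_kernel m p s) \<le> sqrt 2 * pi * (norm s)\<^sup>2 / \<bar>Im s\<bar> * exp (pi * (m + p) * norm s)"
proof -
  have up: "norm (sin (of_real (pi * real n) * s)) \<le> pi * real n * norm s * exp (pi * real n * norm s)" for n
    using norm_sin_le_mult_exp[of "of_real (pi * real n) * s"] by (simp add: norm_mult)
  have lo: "pi * real (m * p) * \<bar>Im s\<bar> / sqrt 2 \<le> norm (sin (of_real (pi * real (m * p)) * s))"
    using norm_sin_ge_Im[of "of_real (pi * real (m * p)) * s"] by (simp add: abs_mult)
  have pos: "0 < pi * real (m * p) * \<bar>Im s\<bar> / sqrt 2" using assms by simp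
  have "norm (torus_kernel m p s) \<le> (pi * real m * norm s * exp (pi * real m * norm s)) *
     (pi * real p * norm s * exp (pi * real p * norm s)) / (pi * real (m * p) * \<bar>Im s\<bar> / sqrt 2)"
    unfolding torus_kernel_def norm_divide norm_mult[of "sin _"]
    by (intro frac_le mult_mono mult_nonneg_nonneg up lo pos) auto
  also have "\<dots> = sqrt 2 * pi * (norm s)\<^sup>2 / \<bar>Im s\<bar> * exp (pi * (m + p) * norm s)"
    using assms by (simp add: field_simps power2_eq_square exp_add)
  finally show ?thesis .
qed

lemma norm_torus_kernel_slant_le:
  assumes "m > 0" "p > 0"
  shows "norm (torus_kernel m p (slant * of_real t)) \<le> 2 * pi * \<bar>t\<bar> * exp (pi * (m + p) * \<bar>t\<bar>)"
proof (cases "t = 0")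
  case False
  have im: "Im (slant * of_real t) = - t / sqrt 2" unfolding Im_slant_mult by simp
  then have "Im (slant * of_real t) \<noteq> 0" using False by simp
  from norm_torus_kernel_le[OF assms this]
  have "norm (torus_kernel m p (slant * of_real t))
      \<le> sqrt 2 * pi * \<bar>t\<bar>\<^sup>2 / (\<bar>t\<bar> / sqrt 2) * exp (pi * (m + p) * \<bar>t\<bar>)"
    unfolding im norm_mult by (simp only: norm_slant norm_of_real mult_1 abs_divide abs_minus_cancel) simp
  moreover have "sqrt 2 * pi * x\<^sup>2 / (x / sqrt 2) = 2 * pi * x" if "x > 0" for x
    using that by (simp add: power2_eq_square)
  from this[of "\<bar>t\<bar>"] have "sqrt 2 * pi * \<bar>t\<bar>\<^sup>2 / (\<bar>t\<bar> / sqrt 2) = 2 * pi * \<bar>t\<bar>"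
    using False by (simp only: zero_less_abs_iff not_False_eq_True)
  ultimately show ?thesis by (simp only:)
qed (simp add: torus_kernel_def)

definition torus_integrand :: "nat \<Rightarrow> nat \<Rightarrow> nat \<Rightarrow> real \<Rightarrow> complex \<Rightarrow> complex" where
  "torus_integrand m p n \<kappa> s = s ^ n * exp (of_real \<kappa> * \<i> * (2 * s - s\<^sup>2)) * torus_kernel m p s"

lemma torus_integrand_decay:
  assumes "m > 0" "p > 0" "\<kappa> > 0"
  obtains B where "\<And>z. 0 \<le> Im z \<Longrightarrow> Im z \<le> 1 \<Longrightarrow> \<bar>Re z\<bar> \<ge> 2 \<Longrightarrow>
     norm (torus_integrand m p n \<kappa> (slant * z)) \<le> B * exp (-\<bar>Re z\<bar>)"
proof
  define A where "A = n + 2 * \<kappa> + pi * (m + p) + 2"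
  define B where "B = 4 * pi * exp (A + \<kappa> + (A + 1)\<^sup>2 / (4 * \<kappa>))"
  fix z assume z: "0 \<le> Im z" "Im z \<le> 1" "\<bar>Re z\<bar> \<ge> 2"
  define x where "x = \<bar>Re z\<bar>"
  have nz: "norm z \<le> x + 1" using cmod_le[of z] z by (simp add: x_def)
  have "norm ((slant * z) ^ n) \<le> (x + 1) ^ n"
    using nz by (simp add: norm_power norm_mult power_mono)
  also have "\<dots> \<le> exp (n * (x + 1))" by (rule power_le_exp_mult) (simp add: x_def)
  finally have 1: "norm ((slant * z) ^ n) \<le> exp (n * (x + 1))" .
  have "Re (of_real \<kappa> * \<i> * (2 * (slant * z) - (slant * z)\<^sup>2))
      = \<kappa> * Re (2 * \<i> * (slant * z)) - \<kappa> * Re (z\<^sup>2)"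
    by (simp add: power_mult_distrib slant_square algebra_simps)
  also have "\<dots> \<le> \<kappa> * (2 * (x + 1)) - \<kappa> * (x\<^sup>2 - 1)"
  proof -
    have "Re (2 * \<i> * (slant * z)) \<le> norm (2 * \<i> * (slant * z))" by (rule complex_Re_le_cmod)
    also have "\<dots> \<le> 2 * (x + 1)" using nz by (simp add: norm_mult)
    finally have a: "Re (2 * \<i> * (slant * z)) \<le> 2 * (x + 1)" .
    have "(Im z)\<^sup>2 \<le> 1" using z by (simp add: power_le_one)
    then have b: "x\<^sup>2 - 1 \<le> Re (z\<^sup>2)" by (simp add: Re_power2 x_def)
    show ?thesis using mult_left_mono[OF a, of \<kappa>] mult_left_mono[OF b, of \<kappa>] assms by linarith
  qed
  also have "\<dots> = - \<kappa> * x\<^sup>2 + 2 * \<kappa> * (x + 1) + \<kappa>" by (simp add: algebra_simps)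
  finally have 2: "norm (exp (of_real \<kappa> * \<i> * (2 * (slant * z) - (slant * z)\<^sup>2)))
      \<le> exp (- \<kappa> * x\<^sup>2 + 2 * \<kappa> * (x + 1) + \<kappa>)"
    by (simp only: norm_exp_eq_Re exp_le_cancel_iff)
  have Im: "\<bar>Im (slant * z)\<bar> \<ge> 1 / sqrt 2"
  proof -
    have "1 \<le> \<bar>Im z - Re z\<bar>" using z by linarith
    then show ?thesis unfolding Im_slant_mult abs_divide by (simp add: divide_right_mono)
  qed
  then have "Im (slant * z) \<noteq> 0" by (auto simp: not_le)
  from norm_torus_kernel_le[OF assms(1,2) this]
  have "norm (torus_kernel m p (slant * z))
     \<le> sqrt 2 * pi * (norm z)\<^sup>2 / \<bar>Im (slant * z)\<bar> * exp (pi * (m + p) * norm z)"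
    by (simp add: norm_mult)
  also have "\<dots> \<le> sqrt 2 * pi * (x + 1)\<^sup>2 / (1 / sqrt 2) * exp (pi * (m + p) * (x + 1))"
    using nz Im by (intro mult_mono frac_le power_mono) (auto simp: mult_left_mono)
  also have "\<dots> = 2 * pi * (x + 1)\<^sup>2 * exp (pi * (m + p) * (x + 1))" by simp
  also have "\<dots> \<le> 4 * pi * exp (2 * (x + 1)) * exp (pi * (m + p) * (x + 1))"
    using power_le_exp_mult[of "x + 1" 2] by (intro mult_mono) (auto simp: x_def)
  finally have 3: "norm (torus_kernel m p (slant * z)) \<le> 4 * pi * exp (2 * (x + 1)) * exp (pi * (m + p) * (x + 1))" .
  have "norm (torus_integrand m p n \<kappa> (slant * z)) \<le> exp (n * (x + 1)) * exp (- \<kappa> * x\<^sup>2 + 2 * \<kappa> * (x + 1) + \<kappa>)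
     * (4 * pi * exp (2 * (x + 1)) * exp (pi * (m + p) * (x + 1)))"
    unfolding torus_integrand_def norm_mult by (intro mult_mono 1[unfolded norm_mult] 2 3) (use 1 2 3 in auto)
  also have "\<dots> = 4 * pi * exp ((- \<kappa> * x\<^sup>2 + A * x) + A + \<kappa>)"
    by (simp add: exp_add[symmetric] A_def algebra_simps)
  also have "\<dots> \<le> 4 * pi * exp (((A + 1)\<^sup>2 / (4 * \<kappa>) - x) + A + \<kappa>)"
    using neg_quadratic_le_neg_abs[OF assms(3), of "Re z" A] by (simp add: x_def)
  also have "\<dots> = B * exp (-\<bar>Re z\<bar>)"
    by (simp add: B_def x_def exp_add[symmetric] algebra_simps)
  finally show "norm (torus_integrand m p n \<kappa> (slant * z)) \<le> B * exp (-\<bar>Re z\<bar>)" .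
qed

text \<open>
  If \<open>j\<close> is a multiple of \<open>m\<close> or of \<open>p\<close>, the singularity is removable; the formula still holds since one
  of the two sines vanishes.  The residue is therefore computed as a limit and not from the order of the pole.
\<close>

lemma residue_torus_integrand:
  fixes m p a j n :: nat
  assumes a: "a = m * p" "a > 0" and "open U" "w \<in> U"
    and hol: "(\<lambda>z. torus_integrand m p n \<kappa> (slant * z)) holomorphic_on U - {w}"
    and w: "slant * w = of_real (j / a)"
  shows "residue (\<lambda>z. torus_integrand m p n \<kappa> (slant * z)) w =
     of_real (j / a) ^ n * exp (of_real \<kappa> * \<i> * (2 * of_real (j / a) - (of_real (j / a))\<^sup>2))
       * (-1) ^ j * of_real (sin (pi * j / p) * sin (pi * j / m)) / (of_real (pi * a) * slant)"
proof (rule residue_simple'[OF assms(3,4) hol])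
  define N where "N z = (slant * z) ^ n * exp (of_real \<kappa> * \<i> * (2 * (slant * z) - (slant * z)\<^sup>2))
     * (sin (of_real (pi * real m) * (slant * z)) * sin (of_real (pi * real p) * (slant * z)))" for z
  define S where "S z = sin (of_real (pi * real a) * (slant * z))" for z
  have mp: "m > 0" "p > 0" using a by auto
  have pj: "of_real (pi * real a) * (slant * w) = of_real (real j * pi)"
    unfolding w of_real_mult[symmetric] using a(2) by simp
  have Sw: "S w = 0" unfolding S_def pj sin_of_real by simp
  have "(S has_field_derivative cos (of_real (pi * real a) * (slant * w)) * (of_real (pi * real a) * slant)) (at w)"
    unfolding S_def by (auto intro!: derivative_eq_intros)
  also have "cos (of_real (pi * real a) * (slant * w)) = ((-1) ^ j :: complex)"
    unfolding pj cos_of_real by simp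
  finally have "((\<lambda>z. S z / (z - w)) \<longlongrightarrow> (-1) ^ j * (of_real (pi * real a) * slant)) (at w)"
    by (simp add: has_field_derivative_iff Sw)
  moreover have "(N \<longlongrightarrow> N w) (at w)"
    unfolding N_def by (intro tendsto_intros)
  ultimately have lim: "((\<lambda>z. N z / (S z / (z - w))) \<longlongrightarrow> N w / ((-1) ^ j * (of_real (pi * real a) * slant))) (at w)"
    using a(2) by (intro tendsto_divide) auto
  have ev: "\<forall>\<^sub>F z in at w. N z / (S z / (z - w)) = torus_integrand m p n \<kappa> (slant * z) * (z - w)"
    using eventually_neq_at_within
    by (rule eventually_mono) (simp add: N_def S_def torus_integrand_def torus_kernel_def a)
  have Nw: "N w = of_real (j / a) ^ n * exp (of_real \<kappa> * \<i> * (2 * of_real (j / a) - (of_real (j / a))\<^sup>2))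
       * of_real (sin (pi * j / p) * sin (pi * j / m))"
  proof -
    have "of_real (pi * real m) * (slant * w) = of_real (pi * j / p)"
         "of_real (pi * real p) * (slant * w) = of_real (pi * j / m)"
      unfolding w using mp by (simp_all add: a)
    then show ?thesis unfolding N_def w by (simp only: sin_of_real of_real_mult)
  qed
  have val: "N w / ((-1) ^ j * (of_real (pi * real a) * slant)) = of_real (j / a) ^ n
       * exp (of_real \<kappa> * \<i> * (2 * of_real (j / a) - (of_real (j / a))\<^sup>2))
       * (-1) ^ j * of_real (sin (pi * j / p) * sin (pi * j / m)) / (of_real (pi * a) * slant)"
    unfolding Nw by (cases "even j") simp_all
  show "((\<lambda>z. torus_integrand m p n \<kappa> (slant * z) * (z - w)) \<longlongrightarrow>
     of_real (j / a) ^ n * exp (of_real \<kappa> * \<i> * (2 * of_real (j / a) - (of_real (j / a))\<^sup>2))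
       * (-1) ^ j * of_real (sin (pi * j / p) * sin (pi * j / m)) / (of_real (pi * a) * slant)) (at w)"
    using Lim_transform_eventually[OF lim ev] unfolding val .
qed

lemma torus_integrand_shift:
  fixes m p n a :: nat
  assumes mp: "m > 0" "p > 0" "coprime m p" and \<kappa>: "\<kappa> > 0" and a: "a = m * p"
  defines "H \<equiv> torus_integrand m p n \<kappa>"
  shows "integrable lborel (\<lambda>t. H (slant * of_real t))"
    and "integrable lborel (\<lambda>t. H (1 + slant * of_real t))"
    and "(\<integral>t. H (slant * of_real t) \<partial>lborel) = (\<integral>t. H (1 + slant * of_real t) \<partial>lborel)
       + 2 * \<i> / (a * slant) * (\<Sum>j=1..<a. of_real (j / a) ^ n *
          exp (of_real \<kappa> * \<i> * (2 * of_real (j / a) - (of_real (j / a))\<^sup>2))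
       * (-1) ^ j * of_real (sin (pi * j / p) * sin (pi * j / m)))"
proof -
  define F where "F z = H (slant * z)" for z
  define P where "P = (\<lambda>j. of_real (j / a) / slant) ` {1..<a}"
  define U where "U = {z. - 1 / a / sqrt 2 < Im z} \<inter> {z. Im z < (1 + 1 / a) / sqrt 2}"
  define y where "y = 1 / sqrt 2"
  have a0: "a > 0" using mp a by simp
  have U: "open U" "connected U"
    unfolding U_def
    by (intro open_Int open_halfspace_Im_gt open_halfspace_Im_lt convex_connected convex_Int convex_halfspace_Im_gt convex_halfspace_Im_lt)+
  have ImP: "Im (of_real x / slant) = x / sqrt 2" for x
    using Re_add_Im_slant_mult[of "of_real x / slant"] by (simp add: field_simps)
  have holU: "F holomorphic_on U - P"
  proof -
    have "(torus_kernel m p \<circ> (\<lambda>z. slant * z)) holomorphic_on U - P"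
    proof (rule holomorphic_on_compose_gen[OF _ holomorphic_torus_kernel[OF mp a]])
      show "(\<lambda>z. slant * z) holomorphic_on U - P" by (intro holomorphic_intros)
      show "(\<lambda>z. slant * z) ` (U - P) \<subseteq> {s. - 1 / a < Re s + Im s \<and> Re s + Im s < 1 + 1 / a} - (\<lambda>j. of_real (j / a)) ` {1..<a}"
      proof (intro subsetI)
        fix s assume "s \<in> (\<lambda>z. slant * z) ` (U - P)"
        then obtain z where z: "s = slant * z" "z \<in> U" "z \<notin> P" by auto
        have "- 1 / a < sqrt 2 * Im z" "sqrt 2 * Im z < 1 + 1 / a"
          using z(2) pos_divide_less_eq[of "sqrt 2" "- 1 / a" "Im z"] pos_less_divide_eq[of "sqrt 2" "Im z" "1 + 1 / a"]
          unfolding U_def by (auto simp only: mem_Collect_eq Int_iff mult.commute zero_less_numeral real_sqrt_gt_0_iff)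
        moreover have "s \<notin> (\<lambda>j. of_real (j / a)) ` {1..<a}"
          using z by (auto simp: P_def field_simps)
        ultimately show "s \<in> {s. - 1 / a < Re s + Im s \<and> Re s + Im s < 1 + 1 / a} - (\<lambda>j. of_real (j / a)) ` {1..<a}"
          unfolding Diff_iff mem_Collect_eq z(1) Re_add_Im_slant_mult by blast
      qed
    qed
    then show ?thesis
      unfolding F_def H_def torus_integrand_def o_def by (intro holomorphic_intros)
  qed
  have y: "0 < y" "y \<le> 1" by (auto simp: y_def)
  obtain B where B: "\<And>z. 0 \<le> Im z \<Longrightarrow> Im z \<le> y \<Longrightarrow> 2 \<le> \<bar>Re z\<bar> \<Longrightarrow> norm (F z) \<le> B * exp (-\<bar>Re z\<bar>)"
    using torus_integrand_decay[OF mp(1,2) \<kappa>, of n] y(2) order_trans unfolding F_def H_def by metis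
  have strip: "{z. 0 \<le> Im z \<and> Im z \<le> y} \<subseteq> U"
  proof -
    have "- 1 / a / sqrt 2 < 0" "y < (1 + 1 / a) / sqrt 2"
      using a0 unfolding y_def by (simp, intro divide_strict_right_mono) simp_all
    then show ?thesis unfolding U_def by (intro subsetI IntI CollectI; unfold mem_Collect_eq; linarith)
  qed
  have P: "finite P" "P \<subseteq> {z. 0 < Im z \<and> Im z < y}"
  proof -
    show "finite P" by (simp add: P_def)
    show "P \<subseteq> {z. 0 < Im z \<and> Im z < y}"
    proof
      fix z assume "z \<in> P"
      then obtain j where j: "j \<in> {1..<a}" "z = of_real (j / a) / slant" by (auto simp: P_def)
      have "0 < q / sqrt 2 \<and> q / sqrt 2 < 1 / sqrt 2" if "0 < q" "q < 1" for q
        using that by (simp add: divide_strict_right_mono)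
      moreover have "0 < real j / a" "real j / a < 1" using j(1) by simp_all
      ultimately show "z \<in> {z. 0 < Im z \<and> Im z < y}"
        unfolding y_def j(2) mem_Collect_eq ImP by blast
    qed
  qed
  note shift = integral_horizontal_shift[OF y(1) U strip P holU B]
  have F0: "F (of_real t) = H (slant * of_real t)" for t by (simp add: F_def)
  have Fy: "F (of_real t + \<i> * of_real y) = H (1 + slant * of_real (t - y))" for t
    by (simp only: F_def y_def slant_mult_shift)
  show "integrable lborel (\<lambda>t. H (slant * of_real t))"
    using shift(1) unfolding F0 .
  have "integrable lborel (\<lambda>t. H (1 + slant * of_real (t - y)))"
    using shift(2) unfolding Fy .
  from lborel_integrable_real_affine[OF this, of 1 y]
  show "integrable lborel (\<lambda>t. H (1 + slant * of_real t))" by (simp add: algebra_simps)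
  have tr: "(\<integral>t. H (1 + slant * of_real (t - y)) \<partial>lborel) = (\<integral>t. H (1 + slant * of_real t) \<partial>lborel)"
    by (subst lborel_integral_real_affine[where c = 1 and t = y]) (simp_all add: algebra_simps)
  have "(\<integral>t. H (slant * of_real t) \<partial>lborel) - (\<integral>t. H (1 + slant * of_real t) \<partial>lborel)
      = 2 * pi * \<i> * (\<Sum>w\<in>P. residue F w)"
    using shift(3) unfolding F0 Fy tr .
  also have "(\<Sum>w\<in>P. residue F w) = (\<Sum>j=1..<a. residue F (of_real (j / a) / slant))"
    unfolding P_def by (subst sum.reindex) (use a0 in \<open>auto simp: inj_on_def\<close>)
  also have "\<dots> = (\<Sum>j=1..<a. of_real (j / a) ^ n *
          exp (of_real \<kappa> * \<i> * (2 * of_real (j / a) - (of_real (j / a))\<^sup>2))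
       * (-1) ^ j * of_real (sin (pi * j / p) * sin (pi * j / m)) / (of_real (pi * a) * slant))"
  proof (rule sum.cong[OF refl])
    fix j assume j: "j \<in> {1..<a}"
    define w where "w = of_real (j / a) / slant"
    have wP: "w \<in> P" using j by (auto simp: P_def w_def)
    have "P \<subseteq> U" using P(2) strip by fastforce
    show "residue F (of_real (j / a) / slant) = of_real (j / a) ^ n *
          exp (of_real \<kappa> * \<i> * (2 * of_real (j / a) - (of_real (j / a))\<^sup>2))
       * (-1) ^ j * of_real (sin (pi * j / p) * sin (pi * j / m)) / (of_real (pi * a) * slant)"
      unfolding w_def[symmetric] F_def H_def
    proof (rule residue_torus_integrand[OF a a0, of "U - (P - {w})"])
      show "open (U - (P - {w}))" using U P by (intro open_Diff finite_imp_closed) auto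
      show "w \<in> U - (P - {w})" using wP \<open>P \<subseteq> U\<close> by auto
      have "U - (P - {w}) - {w} = U - P" using wP by auto
      then show "(\<lambda>z. torus_integrand m p n \<kappa> (slant * z)) holomorphic_on U - (P - {w}) - {w}"
        using holU by (simp add: F_def[abs_def] H_def)
      show "slant * w = of_real (j / a)" by (simp add: w_def)
    qed
  qed
  also have "\<dots> = (\<Sum>j=1..<a. of_real (j / a) ^ n *
          exp (of_real \<kappa> * \<i> * (2 * of_real (j / a) - (of_real (j / a))\<^sup>2))
       * (-1) ^ j * of_real (sin (pi * j / p) * sin (pi * j / m))) / (of_real (pi * a) * slant)" (is "_ = ?S / _")
    by (rule sum_divide_distrib[symmetric])
  also have "2 * pi * \<i> * (?S / (of_real (pi * a) * slant)) = 2 * \<i> / (a * slant) * ?S"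
    by (simp only: of_real_mult) (simp add: divide_simps)
  finally show "(\<integral>t. H (slant * of_real t) \<partial>lborel) = (\<integral>t. H (1 + slant * of_real t) \<partial>lborel)
       + 2 * \<i> / (a * slant) * ?S"
    by (simp only: diff_eq_eq add.commute)
qed

section \<open>Gauss sums as integrals of the torus kernel\<close>

lemma integral_odd_eq_0:
  fixes g :: "real \<Rightarrow> complex"
  assumes "\<And>t. g (- t) = - g t"
  shows "(\<integral>t. g t \<partial>lborel) = 0"
proof -
  have "(\<integral>t. g t \<partial>lborel) = (\<integral>t. g (- t) \<partial>lborel)"
    by (subst lborel_integral_real_affine[where c = "-1" and t = 0]) simp_all
  then show ?thesis by (simp add: assms)
qed

lemma integral_eq_if_even_parts_eq:
  fixes f g :: "real \<Rightarrow> complex"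
  assumes int: "integrable lborel f" "integrable lborel g"
    and eq: "\<And>t. f t + f (- t) = g t + g (- t)"
  shows "(\<integral>t. f t \<partial>lborel) = (\<integral>t. g t \<partial>lborel)"
proof -
  have "(\<integral>t. f t - g t \<partial>lborel) = 0"
    by (rule integral_odd_eq_0) (use eq in \<open>simp add: algebra_simps\<close>)
  then show ?thesis using int by simp
qed

lemma gaussian_quadratic_mean:
  fixes d :: complex and \<kappa> :: real
  assumes \<kappa>: "\<kappa> > 0"
  shows "(\<integral>t. exp (- of_real \<kappa> * (of_real t - d)\<^sup>2) \<partial>lborel) = of_real (sqrt (pi / \<kappa>))"
    and "(\<integral>t. (of_real t)\<^sup>2 * exp (- of_real \<kappa> * (of_real t - d)\<^sup>2) \<partial>lborel)
       = of_real (sqrt (pi / \<kappa>)) * (1 / of_real (2 * \<kappa>) + d\<^sup>2)"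
proof -
  note moments = has_bochner_integral_gaussian_moment[OF \<kappa>]
  have g: "has_bochner_integral lborel (\<lambda>t. complex_of_real (exp (-\<kappa> * t\<^sup>2))) (of_real (sqrt (pi / \<kappa>)))"
    "has_bochner_integral lborel (\<lambda>t. complex_of_real (t * exp (-\<kappa> * t\<^sup>2))) (of_real 0)"
    "has_bochner_integral lborel (\<lambda>t. complex_of_real (t\<^sup>2 * exp (-\<kappa> * t\<^sup>2))) (of_real (sqrt (pi / \<kappa>) / (2 * \<kappa>)))"
    by (intro has_bochner_integral_of_real moments)+
  show "(\<integral>t. exp (- of_real \<kappa> * (of_real t - d)\<^sup>2) \<partial>lborel) = of_real (sqrt (pi / \<kappa>))"
    using gaussian_shift(2)[OF \<kappa>, of 0 d] has_bochner_integral_integral_eq[OF g(1)]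
    by (simp add: exp_of_real[symmetric])
  have "has_bochner_integral lborel (\<lambda>t. of_real (t\<^sup>2 * exp (-\<kappa> * t\<^sup>2)) + 2 * d * of_real (t * exp (-\<kappa> * t\<^sup>2))
      + d\<^sup>2 * of_real (exp (-\<kappa> * t\<^sup>2)))
     (of_real (sqrt (pi / \<kappa>) / (2 * \<kappa>)) + 2 * d * of_real 0 + d\<^sup>2 * of_real (sqrt (pi / \<kappa>)))"
    by (intro has_bochner_integral_add has_bochner_integral_mult_right g)
  from has_bochner_integral_integral_eq[OF this]
  have "(\<integral>t. (of_real t + d) ^ 2 * exp (- of_real (\<kappa> * t\<^sup>2)) \<partial>lborel)
      = of_real (sqrt (pi / \<kappa>) / (2 * \<kappa>)) + d\<^sup>2 * of_real (sqrt (pi / \<kappa>))"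
    by (simp add: exp_of_real[symmetric] power2_sum algebra_simps)
  then show "(\<integral>t. (of_real t)\<^sup>2 * exp (- of_real \<kappa> * (of_real t - d)\<^sup>2) \<partial>lborel)
       = of_real (sqrt (pi / \<kappa>)) * (1 / of_real (2 * \<kappa>) + d\<^sup>2)"
    using gaussian_shift(2)[OF \<kappa>, of 2 d] by (simp add: algebra_simps)
qed

text \<open>
  Integrating over \<open>t\<close> produces \<open>exp (2 \<pi> \<i> a x\<^sup>2 / k)\<close>, weighted by a polynomial in \<open>x\<close> of degree \<open>n\<close>.
  Since \<open>x\<close> enters only linearly in the exponent, sums over arithmetic progressions of \<open>x\<close> are geometric.
\<close>

definition slant_wave :: "nat \<Rightarrow> real \<Rightarrow> real \<Rightarrow> real \<Rightarrow> real \<Rightarrow> complex" where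
  "slant_wave n a k x t = (slant * of_real t) ^ n
     * exp (- of_real (pi * a * k / 2) * (of_real t)\<^sup>2 + 2 * of_real (pi * a * x) * \<i> * slant * of_real t)"

lemma slant_wave_integral:
  fixes a k x :: real
  assumes "a > 0" "k > 0"
  defines "\<kappa> \<equiv> pi * a * k / 2" and "E \<equiv> exp (2 * pi * \<i> * of_real (a * x\<^sup>2 / k))"
  shows "integrable lborel (slant_wave n a k x)"
    and "(\<integral>t. slant_wave 0 a k x t \<partial>lborel) = of_real (sqrt (pi / \<kappa>)) * E"
    and "(\<integral>t. slant_wave 2 a k x t \<partial>lborel)
        = of_real (sqrt (pi / \<kappa>)) * (of_real (4 * x\<^sup>2 / k\<^sup>2) - \<i> / of_real (2 * \<kappa>)) * E"
proof -
  \<comment> \<open>The centre of the Gaussian obtained by completing the square in \<open>t\<close>.\<close>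
  define d where "d = 2 * \<i> * of_real (x / k) * slant"
  have \<kappa>: "\<kappa> > 0" using assms by simp
  have d2: "slant\<^sup>2 * d\<^sup>2 = of_real (4 * x\<^sup>2 / k\<^sup>2)"
    by (simp add: d_def power_mult_distrib slant_square power_divide mult_ac)
  have kd2: "of_real \<kappa> * d\<^sup>2 = 2 * pi * \<i> * of_real (a * x\<^sup>2 / k)"
  proof -
    have "d\<^sup>2 = 4 * \<i> * of_real (x\<^sup>2 / k\<^sup>2)"
      by (simp add: d_def power_mult_distrib slant_square power_divide mult_ac)
    then show ?thesis using assms by (simp add: \<kappa>_def power2_eq_square field_simps)
  qed
  have kd: "2 * of_real \<kappa> * d = 2 * of_real (pi * a * x) * \<i> * slant"
    using assms by (simp add: d_def \<kappa>_def field_simps)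
  have expo: "- of_real \<kappa> * (of_real t)\<^sup>2 + 2 * of_real (pi * a * x) * \<i> * slant * of_real t
      = - of_real \<kappa> * (of_real t - d)\<^sup>2 + 2 * pi * \<i> * of_real (a * x\<^sup>2 / k)" for t
    unfolding kd[symmetric] kd2[symmetric] by (simp add: power2_diff algebra_simps)
  have wave: "slant_wave n a k x t = slant ^ n * E * (of_real t ^ n * exp (- of_real \<kappa> * (of_real t - d)\<^sup>2))" for n t
    unfolding slant_wave_def \<kappa>_def[symmetric] expo exp_add E_def by (simp add: power_mult_distrib)
  show "integrable lborel (slant_wave n a k x)"
    unfolding wave[abs_def] by (intro integrable_mult_right gaussian_shift \<kappa>)
  show "(\<integral>t. slant_wave 0 a k x t \<partial>lborel) = of_real (sqrt (pi / \<kappa>)) * E"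
    unfolding wave using gaussian_quadratic_mean(1)[OF \<kappa>, of d] by simp
  have "(\<integral>t. slant_wave 2 a k x t \<partial>lborel)
      = slant ^ 2 * E * (of_real (sqrt (pi / \<kappa>)) * (1 / of_real (2 * \<kappa>) + d\<^sup>2))"
    unfolding wave integral_mult_right_zero gaussian_quadratic_mean(2)[OF \<kappa>, of d] ..
  also have "\<dots> = of_real (sqrt (pi / \<kappa>)) * (slant\<^sup>2 * d\<^sup>2 + slant\<^sup>2 / of_real (2 * \<kappa>)) * E"
    by (simp add: algebra_simps)
  also have "\<dots> = of_real (sqrt (pi / \<kappa>)) * (of_real (4 * x\<^sup>2 / k\<^sup>2) - \<i> / of_real (2 * \<kappa>)) * E"
    by (subst d2) (simp add: slant_square)
  finally show "(\<integral>t. slant_wave 2 a k x t \<partial>lborel)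
        = of_real (sqrt (pi / \<kappa>)) * (of_real (4 * x\<^sup>2 / k\<^sup>2) - \<i> / of_real (2 * \<kappa>)) * E" .
qed

lemma dirichlet_kernel_sum:
  fixes \<theta> :: complex
  shows "(\<Sum>j<k. exp (2 * \<i> * \<theta> * of_real (real j - (real k - 1) / 2))) * sin \<theta> = sin (of_nat k * \<theta>)"
proof -
  define f where "f j = exp (\<i> * \<theta> * of_real (2 * real j - real k))" for j
  have "exp (2 * \<i> * \<theta> * of_real (real j - (real k - 1) / 2)) * sin \<theta> = (f (Suc j) - f j) / (2 * \<i>)" for j
  proof -
    define r where "r = real j - (real k - 1) / 2"
    have r: "2 * real (Suc j) - real k = 2 * r + 1" "2 * real j - real k = 2 * r - 1"
      by (simp_all add: r_def field_simps)
    have "f (Suc j) = exp (2 * \<i> * \<theta> * of_real (real j - (real k - 1) / 2)) * exp (\<i> * \<theta>)"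
         "f j = exp (2 * \<i> * \<theta> * of_real (real j - (real k - 1) / 2)) * exp (- (\<i> * \<theta>))"
      unfolding f_def exp_add[symmetric] r r_def[symmetric] by (rule arg_cong[of _ _ exp], simp add: algebra_simps)+
    then show ?thesis by (simp add: sin_exp_eq' right_diff_distrib sin_exp_eq)
  qed
  then have "(\<Sum>j<k. exp (2 * \<i> * \<theta> * of_real (real j - (real k - 1) / 2))) * sin \<theta> = (\<Sum>j<k. f (Suc j) - f j) / (2 * \<i>)"
    by (simp only: sum_distrib_right sum_divide_distrib)
  also have "(\<Sum>j<k. f (Suc j) - f j) = f k - f 0" by (rule sum_lessThan_telescope)
  also have "(f k - f 0) / (2 * \<i>) = sin (of_nat k * \<theta>)"
    by (simp add: f_def sin_exp_eq mult_ac)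
  finally show ?thesis .
qed

text \<open>
  The summand of \<open>pole_sum\<close> is the residue at \<open>j / (m p)\<close> of the integrand with weight \<open>s\<^sup>n\<close>, taken in the
  rotated variable \<open>s / \<omega>\<close> and without the common factor \<open>1 / (\<pi> m p \<omega>)\<close>.
\<close>

definition pole_term :: "nat \<Rightarrow> nat \<Rightarrow> nat \<Rightarrow> nat \<Rightarrow> complex" where
  "pole_term m p k j = (-1) ^ (j * (k + 1)) * of_real (sin (pi * j / p) * sin (pi * j / m))
     * exp (- (pi * \<i> * of_real (k * real j ^ 2 / (2 * (m * p)))))"

definition pole_sum :: "nat \<Rightarrow> nat \<Rightarrow> nat \<Rightarrow> nat \<Rightarrow> complex" where
  "pole_sum m p n k = (\<Sum>j=1..<m * p. of_real (j / (m * p)) ^ n * pole_term m p k j)"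

definition kernel_moment :: "nat \<Rightarrow> nat \<Rightarrow> real \<Rightarrow> complex" where
  "kernel_moment m p \<kappa> = (\<integral>t. of_real t * exp (- of_real (\<kappa> * t\<^sup>2)) * torus_kernel m p (slant * of_real t) \<partial>lborel)"

lemma torus_integrand_1_add:
  assumes "coprime m p"
  shows "torus_integrand m p n \<kappa> (1 + slant * of_real t)
     = - exp (\<i> * of_real \<kappa>) * ((1 + slant * of_real t) ^ n * exp (- of_real (\<kappa> * t\<^sup>2)) * torus_kernel m p (slant * of_real t))"
proof -
  have sq: "(slant * of_real t)\<^sup>2 = - (\<i> * of_real (t\<^sup>2))"
    by (simp add: power_mult_distrib slant_square)
  have "of_real \<kappa> * \<i> * (2 * (1 + slant * of_real t) - (1 + slant * of_real t)\<^sup>2)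
      = of_real \<kappa> * \<i> * (1 - (slant * of_real t)\<^sup>2)"
    by (simp add: power2_eq_square algebra_simps)
  also have "\<dots> = \<i> * of_real \<kappa> + - of_real (\<kappa> * t\<^sup>2)"
    unfolding sq by (simp add: algebra_simps)
  finally show ?thesis
    unfolding torus_integrand_def by (simp only: exp_add torus_kernel_add_1[OF assms]) (simp add: mult_ac)
qed

text \<open>
  By oddness of the kernel, only the part of \<open>(1 + \<omega> t)\<^sup>n\<close> that is odd in \<open>t\<close> contributes.
\<close>

lemma integral_shifted_torus_integrand:
  assumes mp: "m > 0" "p > 0" "coprime m p" and \<kappa>: "\<kappa> > 0"
  shows "(\<integral>t. torus_integrand m p 0 \<kappa> (1 + slant * of_real t) \<partial>lborel) = 0"
    and "(\<integral>t. torus_integrand m p 2 \<kappa> (1 + slant * of_real t) \<partial>lborel)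
       = - 2 * slant * exp (\<i> * of_real \<kappa>) * kernel_moment m p \<kappa>"
proof -
  define K where "K t = torus_kernel m p (slant * of_real t)" for t :: real
  have K: "K (- t) = - K t" for t by (simp add: K_def torus_kernel_minus)
  show "(\<integral>t. torus_integrand m p 0 \<kappa> (1 + slant * of_real t) \<partial>lborel) = 0"
    by (rule integral_odd_eq_0, unfold torus_integrand_1_add[OF mp(3)]) (simp add: torus_kernel_minus)
  define f where "f t = torus_integrand m p 2 \<kappa> (1 + slant * of_real t)" for t
  define g where "g t = - 2 * slant * exp (\<i> * of_real \<kappa>) * (of_real t * exp (- of_real (\<kappa> * t\<^sup>2)) * K t)" for t
  have f: "f t = - exp (\<i> * of_real \<kappa>) * ((1 + slant * of_real t)\<^sup>2 * exp (- of_real (\<kappa> * t\<^sup>2)) * K t)" for t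
    unfolding f_def K_def by (rule torus_integrand_1_add[OF mp(3)])
  have eq: "f t + f (- t) = g t + g (- t)" for t
    unfolding f g_def K by (simp add: power2_eq_square algebra_simps)
  have intf: "integrable lborel f"
    unfolding f_def using torus_integrand_shift(2)[OF mp \<kappa> refl] .
  have intf': "integrable lborel (\<lambda>t. f (- t))"
    using lborel_integrable_real_affine[OF intf, of "-1" 0] by simp
  have "g t = (f t + f (- t)) / 2" for t
    unfolding eq by (simp add: g_def K)
  then have "g = (\<lambda>t. (f t + f (- t)) / 2)" by (rule ext)
  moreover have "integrable lborel (\<lambda>t. (f t + f (- t)) / 2)"
    by (intro integrable_divide_zero Bochner_Integration.integrable_add intf intf')
  ultimately have "integrable lborel g" by simp
  from integral_eq_if_even_parts_eq[OF intf this eq]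
  show "(\<integral>t. torus_integrand m p 2 \<kappa> (1 + slant * of_real t) \<partial>lborel)
       = - 2 * slant * exp (\<i> * of_real \<kappa>) * kernel_moment m p \<kappa>"
    by (simp add: f_def g_def kernel_moment_def K_def)
qed

lemma torus_integrand_integral:
  assumes mp: "m > 0" "p > 0" "coprime m p" and k: "k > 0"
  defines "\<kappa> \<equiv> pi * real (m * p) * real k / 2"
  shows "(\<integral>t. torus_integrand m p 0 \<kappa> (slant * of_real t) \<partial>lborel)
         = 2 * \<i> / (of_nat (m * p) * slant) * pole_sum m p 0 k"
    and "(\<integral>t. torus_integrand m p 2 \<kappa> (slant * of_real t) \<partial>lborel)
         = - 2 * slant * exp (\<i> * of_real \<kappa>) * kernel_moment m p \<kappa>
           + 2 * \<i> / (of_nat (m * p) * slant) * pole_sum m p 2 k"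
proof -
  have \<kappa>: "\<kappa> > 0" using mp k by (simp add: \<kappa>_def)
  have a0: "real (m * p) > 0" using mp by simp
  have expo: "exp (of_real \<kappa> * \<i> * (2 * of_real (j / real (m * p)) - (of_real (j / real (m * p)))\<^sup>2)) * (-1) ^ j
        * of_real (sin (pi * j / p) * sin (pi * j / m)) = pole_term m p k j" for j :: nat
  proof -
    define a where "a = real (m * p)"
    have "of_real \<kappa> * \<i> * (2 * of_real (j / a) - (of_real (j / a))\<^sup>2)
        = of_nat (j * k) * (of_real pi * \<i>) + - (pi * \<i> * of_real (k * real j ^ 2 / (2 * a)))"
      using a0 unfolding \<kappa>_def a_def[symmetric] by (simp add: power2_eq_square field_simps)
    then have "exp (of_real \<kappa> * \<i> * (2 * of_real (j / a) - (of_real (j / a))\<^sup>2))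
        = (-1) ^ (j * k) * exp (- (pi * \<i> * of_real (k * real j ^ 2 / (2 * a))))"
      by (simp only: exp_add exp_of_nat_mult exp_pi_i)
    then show ?thesis by (simp add: pole_term_def a_def power_add mult_ac)
  qed
  have "(\<Sum>j=1..<m * p. of_real (j / real (m * p)) ^ n *
          exp (of_real \<kappa> * \<i> * (2 * of_real (j / real (m * p)) - (of_real (j / real (m * p)))\<^sup>2))
       * (-1) ^ j * of_real (sin (pi * j / p) * sin (pi * j / m))) = pole_sum m p n k" for n
    unfolding pole_sum_def expo[symmetric] by (intro sum.cong refl) (simp add: mult_ac)
  note sh = torus_integrand_shift(3)[OF mp \<kappa> refl, unfolded this]
  show "(\<integral>t. torus_integrand m p 0 \<kappa> (slant * of_real t) \<partial>lborel)
         = 2 * \<i> / (of_nat (m * p) * slant) * pole_sum m p 0 k"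
    unfolding sh integral_shifted_torus_integrand[OF mp \<kappa>] by simp
  show "(\<integral>t. torus_integrand m p 2 \<kappa> (slant * of_real t) \<partial>lborel)
         = - 2 * slant * exp (\<i> * of_real \<kappa>) * kernel_moment m p \<kappa>
           + 2 * \<i> / (of_nat (m * p) * slant) * pole_sum m p 2 k"
    unfolding sh integral_shifted_torus_integrand[OF mp \<kappa>] by simp
qed

text \<open>
  These are the points at which the square in the exponent of the torus knot sum, once completed, is
  evaluated.
\<close>

definition gauss_node :: "nat \<Rightarrow> nat \<Rightarrow> nat \<Rightarrow> real \<Rightarrow> nat \<Rightarrow> real" where
  "gauss_node m p k \<epsilon> j = real j - (real k - 1) / 2 + 1 / (2 * p) + \<epsilon> / (2 * m)"

lemma sum_slant_wave:
  fixes m p k n :: nat and t :: real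
  assumes mp: "m > 0" "p > 0"
  defines "a \<equiv> real (m * p)" and "s \<equiv> slant * of_real t"
  defines "W \<equiv> \<lambda>t. \<Sum>j<k. \<Sum>\<epsilon>\<in>{1, -1}. of_real \<epsilon> * slant_wave n a k (gauss_node m p k \<epsilon> j) t"
  shows "W t = s ^ n * exp (- of_real (pi * a * k / 2) * (of_real t)\<^sup>2)
     * (\<Sum>j<k. exp (2 * \<i> * (of_real (pi * a) * s) * of_real (real j - (real k - 1) / 2)))
     * exp (\<i> * (of_real (pi * m) * s)) * (2 * \<i> * sin (of_real (pi * p) * s))"
proof -
  have wave: "slant_wave n a k (gauss_node m p k \<epsilon> j) t = s ^ n * exp (- of_real (pi * a * k / 2) * (of_real t)\<^sup>2)
     * exp (2 * \<i> * (of_real (pi * a) * s) * of_real (real j - (real k - 1) / 2))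
     * exp (\<i> * (of_real (pi * m) * s)) * exp (of_real \<epsilon> * (\<i> * (of_real (pi * p) * s)))" for \<epsilon> j
  proof -
    define r where "r = real j - (real k - 1) / 2"
    have "a * gauss_node m p k \<epsilon> j = a * r + m / 2 + \<epsilon> * p / 2"
      using mp unfolding gauss_node_def r_def[symmetric] a_def by (simp add: field_simps)
    then have "2 * of_real (pi * a * gauss_node m p k \<epsilon> j) * \<i> * slant * of_real t
      = 2 * of_real (pi * (a * r + m / 2 + \<epsilon> * p / 2)) * \<i> * s" by (simp add: s_def mult.assoc)
    also have "\<dots> = 2 * \<i> * (of_real (pi * a) * s) * of_real r + \<i> * (of_real (pi * m) * s) + of_real \<epsilon> * (\<i> * (of_real (pi * p) * s))"
      by (simp add: algebra_simps)
    finally show ?thesis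
      unfolding slant_wave_def exp_add s_def[symmetric] r_def[symmetric]
      by (simp only: exp_add mult.assoc)
  qed
  have sin2: "2 * \<i> * sin z = exp (\<i> * z) - exp (- (\<i> * z))" for z :: complex
    by (simp add: sin_exp_eq)
  have "W t = (\<Sum>j<k. s ^ n * exp (- of_real (pi * a * k / 2) * (of_real t)\<^sup>2)
     * exp (2 * \<i> * (of_real (pi * a) * s) * of_real (real j - (real k - 1) / 2))
     * exp (\<i> * (of_real (pi * m) * s)) * (2 * \<i> * sin (of_real (pi * p) * s)))"
    unfolding W_def wave sin2 by (intro sum.cong refl) (simp add: algebra_simps)
  then show ?thesis
    by (simp only: sum_distrib_left[symmetric] sum_distrib_right[symmetric])
qed

text \<open>
  The even part of the sum over all nodes is the Dirichlet kernel \<open>sin (\<pi> a k s) / sin (\<pi> a s)\<close> times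
  \<open>sin (\<pi> m s) sin (\<pi> p s)\<close>, so the numerator of the torus kernel comes from the offsets \<open>1/(2p) \<plusminus> 1/(2m)\<close>
  and its denominator from the summation over \<open>j\<close>.  The factor \<open>sin (\<pi> a k s)\<close> is in turn the odd part of
  \<open>exp (2 \<i> \<kappa> s)\<close>, which is how the saddle point moves from 0 to 1.
\<close>

lemma sum_slant_wave_even_part:
  fixes m p k n :: nat and t :: real
  assumes mp: "m > 0" "p > 0" and n: "even n"
  defines "a \<equiv> real (m * p)"
  defines "W \<equiv> \<lambda>t. \<Sum>j<k. \<Sum>\<epsilon>\<in>{1, -1}. of_real \<epsilon> * slant_wave n a k (gauss_node m p k \<epsilon> j) t"
    and "V \<equiv> \<lambda>t. 2 * \<i> * torus_integrand m p n (pi * a * k / 2) (slant * of_real t)"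
  shows "W t + W (- t) = V t + V (- t)"
proof (cases "t = 0")
  case True
  have "W 0 = 0" unfolding W_def a_def sum_slant_wave[OF mp] by simp
  moreover have "V 0 = 0" by (simp add: V_def torus_integrand_def torus_kernel_def)
  ultimately show ?thesis using True by simp
next
  case False
  define s where "s = slant * of_real t"
  define D where "D s = (\<Sum>j<k. exp (2 * \<i> * (of_real (pi * a) * s) * of_real (real j - (real k - 1) / 2)))" for s
  define \<theta> where "\<theta> = of_real (pi * a) * s"
  define e :: complex where "e = exp (- of_real (pi * a * k / 2) * (of_real t)\<^sup>2)"
  have a0: "a > 0" using mp by (simp add: a_def)
  have "Im \<theta> = pi * a * Im s" by (simp add: \<theta>_def)
  moreover have "Im s = - t / sqrt 2" unfolding s_def Im_slant_mult by simp
  ultimately have "Im \<theta> \<noteq> 0" using False a0 by simp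
  then have "0 < \<bar>Im \<theta>\<bar> / sqrt 2" by simp
  then have sin0: "sin \<theta> \<noteq> 0" using norm_sin_ge_Im[of \<theta>] by (metis norm_zero not_less)
  define Q where "Q = sin (of_nat k * \<theta>) / sin \<theta>"
  have D: "D s = Q" "D (- s) = Q"
    using dirichlet_kernel_sum[where k = k and \<theta> = \<theta>] dirichlet_kernel_sum[where k = k and \<theta> = "- \<theta>"] sin0
    by (simp_all add: Q_def D_def \<theta>_def field_simps)
  have sm: "slant * of_real (- t) = - s" by (simp add: s_def)
  have pn: "(- s) ^ n = s ^ n" using n by simp
  have W1: "W t = s ^ n * e * D s * exp (\<i> * (of_real (pi * m) * s)) * (2 * \<i> * sin (of_real (pi * p) * s))"
    unfolding W_def a_def sum_slant_wave[OF mp] s_def[symmetric] D_def[symmetric] e_def by (simp add: D_def a_def)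
  have W2: "W (- t) = (- s) ^ n * e * D (- s) * exp (\<i> * (of_real (pi * m) * (- s))) * (2 * \<i> * sin (of_real (pi * p) * (- s)))"
    unfolding W_def a_def sum_slant_wave[OF mp] sm e_def by (simp add: D_def a_def)
  have "W t + W (- t) = s ^ n * e * Q * (2 * \<i> * sin (of_real (pi * p) * s))
      * (exp (\<i> * (of_real (pi * m) * s)) - exp (- (\<i> * (of_real (pi * m) * s))))"
    unfolding W1 W2 D pn by (simp add: algebra_simps)
  also have "exp (\<i> * (of_real (pi * m) * s)) - exp (- (\<i> * (of_real (pi * m) * s))) = 2 * \<i> * sin (of_real (pi * m) * s)"
    by (simp add: sin_exp_eq)
  also have "s ^ n * e * Q * (2 * \<i> * sin (of_real (pi * p) * s)) * (2 * \<i> * sin (of_real (pi * m) * s))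
     = - 4 * s ^ n * e * sin (of_nat k * \<theta>) * torus_kernel m p s"
    by (simp add: Q_def torus_kernel_def \<theta>_def a_def mult_ac)
  also have "\<dots> = V t + V (- t)"
  proof -
    have s2: "s\<^sup>2 = - (\<i> * of_real (t\<^sup>2))" by (simp add: s_def power_mult_distrib slant_square)
    have ex: "exp (of_real (pi * a * k / 2) * \<i> * (2 * \<sigma> - s\<^sup>2)) = exp (\<i> * (of_nat k * (of_real (pi * a) * \<sigma>))) * e" for \<sigma>
      unfolding e_def exp_add[symmetric] s2 by (rule arg_cong[of _ _ exp]) (simp add: field_simps)
    have "V t = 2 * \<i> * (s ^ n * (exp (\<i> * (of_nat k * \<theta>)) * e) * torus_kernel m p s)"
      unfolding V_def s_def[symmetric] torus_integrand_def ex \<theta>_def ..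
    moreover have "V (- t) = 2 * \<i> * (s ^ n * (exp (\<i> * (of_nat k * (of_real (pi * a) * (- s)))) * e) * (- torus_kernel m p s))"
      unfolding V_def sm torus_integrand_def torus_kernel_minus power2_minus ex pn ..
    ultimately have "V t + V (- t) = 2 * \<i> * s ^ n * e * torus_kernel m p s * (exp (\<i> * (of_nat k * \<theta>)) - exp (- (\<i> * (of_nat k * \<theta>))))"
      by (simp add: \<theta>_def algebra_simps)
    also have "exp (\<i> * (of_nat k * \<theta>)) - exp (- (\<i> * (of_nat k * \<theta>))) = 2 * \<i> * sin (of_nat k * \<theta>)"
      by (simp add: sin_exp_eq)
    finally show ?thesis by (simp add: mult_ac)
  qed
  finally show ?thesis .
qed

lemma sum_slant_wave_integral:
  fixes m p k n :: nat
  assumes mp: "m > 0" "p > 0" "coprime m p" and n: "even n" and k: "k > 0"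
  shows "(\<Sum>j<k. \<Sum>\<epsilon>\<in>{1, -1}. of_real \<epsilon> * (\<integral>t. slant_wave n (real (m * p)) k (gauss_node m p k \<epsilon> j) t \<partial>lborel))
     = 2 * \<i> * (\<integral>t. torus_integrand m p n (pi * real (m * p) * real k / 2) (slant * of_real t) \<partial>lborel)"
proof -
  define a where "a = real (m * p)"
  have a0: "a > 0" and k0: "real k > 0" using mp k by (simp_all add: a_def)
  have \<kappa>: "pi * a * real k / 2 > 0" using a0 k0 by simp
  define W where "W = (\<lambda>t. \<Sum>j<k. \<Sum>\<epsilon>\<in>{1, -1}. of_real \<epsilon> * slant_wave n a k (gauss_node m p k \<epsilon> j) t)"
  define V where "V = (\<lambda>t. 2 * \<i> * torus_integrand m p n (pi * a * k / 2) (slant * of_real t))"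
  note intw = slant_wave_integral(1)[OF a0 k0]
  have iW: "integrable lborel W"
    unfolding W_def by (intro Bochner_Integration.integrable_sum integrable_mult_right intw)
  have iV: "integrable lborel V"
    unfolding V_def using torus_integrand_shift(1)[OF mp \<kappa> refl, of n] by simp
  have "(\<integral>t. W t \<partial>lborel) = (\<integral>t. V t \<partial>lborel)"
    by (rule integral_eq_if_even_parts_eq[OF iW iV])
       (unfold W_def V_def a_def, rule sum_slant_wave_even_part[OF mp(1,2) n])
  moreover have "(\<integral>t. W t \<partial>lborel) = (\<Sum>j<k. \<Sum>\<epsilon>\<in>{1, -1}. of_real \<epsilon> * (\<integral>t. slant_wave n a k (gauss_node m p k \<epsilon> j) t \<partial>lborel))"
    unfolding W_def
    by (subst Bochner_Integration.integral_sum, (intro Bochner_Integration.integrable_sum integrable_mult_right intw)[1])+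
       (simp add: intw)
  ultimately show ?thesis unfolding V_def a_def by simp
qed

section \<open>The residue sums\<close>

lemma exp_pi_i_int_even: "exp (of_real pi * \<i> * (2 * of_int n)) = 1"
  using exp_integer_2pi[of "of_int n"] by (simp add: mult_ac)

text \<open>
  The extension of \<open>pole_term\<close> to integer indices, on which multiplication by a residue class modulo
  \<open>2 m p\<close> can act.
\<close>

definition pole_term_int :: "nat \<Rightarrow> nat \<Rightarrow> nat \<Rightarrow> int \<Rightarrow> complex" where
  "pole_term_int m p k j = (if even j \<or> odd k then 1 else -1) * of_real (sin (pi * j / p) * sin (pi * j / m))
     * exp (- (pi * \<i> * of_real (k * real_of_int j ^ 2 / (2 * (m * p)))))"

lemma sin_add_2pi_multiple:
  fixes x :: real and n :: int
  shows "sin (x + 2 * pi * n) = sin x"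
  using sin.plus_of_int[of x n] by (simp add: mult_ac)

lemma exp_quadratic_phase_cong:
  fixes j j' :: int and m p k :: nat
  assumes "m > 0" "p > 0" and d: "int (4 * m * p) dvd j'\<^sup>2 - j\<^sup>2"
  shows "exp (- (pi * \<i> * of_real (k * real_of_int j' ^ 2 / (2 * (m * p)))))
       = exp (- (pi * \<i> * of_real (k * real_of_int j ^ 2 / (2 * (m * p)))))"
proof -
  obtain v where "j'\<^sup>2 - j\<^sup>2 = int (4 * m * p) * v" using d by (auto simp: dvd_def)
  then have "real_of_int (j'\<^sup>2 - j\<^sup>2) = real_of_int (int (4 * m * p) * v)" by simp
  then have "real_of_int j' ^ 2 = real_of_int j ^ 2 + 4 * real m * real p * real_of_int v" by simp
  then have "k * real_of_int j' ^ 2 / (2 * (m * p)) = k * real_of_int j ^ 2 / (2 * (m * p)) + 2 * real_of_int (int k * v)"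
    using assms by (simp add: field_simps)
  then have "- (pi * \<i> * of_real (k * real_of_int j' ^ 2 / (2 * (m * p))))
     = - (pi * \<i> * of_real (k * real_of_int j ^ 2 / (2 * (m * p)))) + pi * \<i> * (2 * of_int (- (int k * v)))"
    by (simp add: algebra_simps)
  then show ?thesis by (simp only: exp_add exp_pi_i_int_even mult_1_right)
qed

lemma pole_term_int_cong:
  assumes mp: "m > 0" "p > 0" and c: "int (2 * m * p) dvd j' - j"
  shows "pole_term_int m p k j' = pole_term_int m p k j"
proof -
  obtain v where v: "j' = j + int (2 * m * p) * v" using c by (auto simp: dvd_def algebra_simps)
  have ev: "even j' = even j" by (simp add: v)
  have "pi * j' / p = pi * j / p + 2 * pi * (int m * v)" "pi * j' / m = pi * j / m + 2 * pi * (int p * v)"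
    using mp by (simp_all add: v field_simps)
  then have s: "sin (pi * j' / p) = sin (pi * j / p)" "sin (pi * j' / m) = sin (pi * j / m)"
    by (simp_all only: sin_add_2pi_multiple)
  have "j'\<^sup>2 - j\<^sup>2 = int (4 * m * p) * (v * j + int m * int p * v\<^sup>2)"
    by (simp add: v power2_eq_square algebra_simps)
  then have "int (4 * m * p) dvd j'\<^sup>2 - j\<^sup>2" by simp
  from exp_quadratic_phase_cong[OF mp this] show ?thesis
    unfolding pole_term_int_def ev s by simp
qed

text \<open>
  A solution \<open>u\<close> of \<open>u \<equiv> 1\<close> modulo \<open>2 p\<close> and \<open>u \<equiv> -1\<close> modulo \<open>2 m\<close> fixes \<open>sin (\<pi> j / p)\<close> and reverses
  \<open>sin (\<pi> j / m)\<close>, while \<open>u\<^sup>2 - 1 = (u - 1) (u + 1)\<close> is divisible by \<open>4 m p\<close>, so that the quadratic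
  phase is unchanged.
\<close>

lemma pole_term_int_reflect:
  assumes mp: "m > 0" "p > 0" "coprime m p"
  obtains u :: int where "\<And>j k. pole_term_int m p k (u * j) = - pole_term_int m p k j"
    "int (4 * m * p) dvd u\<^sup>2 - 1"
proof -
  obtain s t' where "s * int p + t' * int m = gcd (int p) (int m)" using bezout_int by blast
  moreover have "gcd (int p) (int m) = 1" using mp(3) by (simp add: gcd.commute)
  ultimately obtain t where t: "int p * s - 1 = int m * t"
    by (metis add_diff_cancel_left' diff_minus_eq_add minus_diff_eq mult.commute mult_minus_right)
  define u where "u = 1 - 2 * int p * s"
  have u': "u = - 1 - 2 * int m * t" using t by (simp add: u_def algebra_simps)
  have "u\<^sup>2 - 1 = (u - 1) * (u + 1)" by (simp add: power2_eq_square algebra_simps)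
  also have "\<dots> = (- 2 * int p * s) * (- 2 * int m * t)" using u_def u' by simp
  finally have u2: "u\<^sup>2 - 1 = int (4 * m * p) * (s * t)" by simp
  show ?thesis
  proof
    show "int (4 * m * p) dvd u\<^sup>2 - 1" using u2 by simp
    fix j :: int and k :: nat
    have ev: "even (u * j) = even j" by (simp add: u_def)
    have "pi * real_of_int (u * j) / p = pi * j / p + 2 * pi * real_of_int (- s * j)"
      using mp by (simp add: u_def field_simps)
    moreover have "pi * real_of_int (u * j) / m = - (pi * j / m) + 2 * pi * real_of_int (- t * j)"
      using mp by (simp add: u' field_simps)
    ultimately have s: "sin (pi * real_of_int (u * j) / p) = sin (pi * j / p)"
      "sin (pi * real_of_int (u * j) / m) = - sin (pi * j / m)"
      by (simp_all only: sin_add_2pi_multiple sin_minus)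
    have "(u * j)\<^sup>2 - j\<^sup>2 = (u\<^sup>2 - 1) * j\<^sup>2" by (simp add: algebra_simps)
    then have "int (4 * m * p) dvd (u * j)\<^sup>2 - j\<^sup>2" using u2 by simp
    from exp_quadratic_phase_cong[OF mp(1,2) this]
    show "pole_term_int m p k (u * j) = - pole_term_int m p k j"
      unfolding pole_term_int_def ev s by simp
  qed
qed

lemma pole_term_int_of_nat: "pole_term_int m p k (int j) = pole_term m p k j"
  by (auto simp: pole_term_int_def pole_term_def minus_one_power_iff)

text \<open>
  The sum over a full period modulo \<open>2 m p\<close> equals its own negative by the reflection \<open>j \<mapsto> u j\<close>.  The symmetry
  \<open>j \<mapsto> - j\<close> makes it twice the sum over \<open>0 < j < m p\<close>.
\<close>

lemma pole_sum_0_eq_0: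
  assumes mp: "m > 0" "p > 0" "coprime m p"
  shows "pole_sum m p 0 k = 0"
proof -
  define N where "N = int (2 * m * p)"
  have N: "N > 0" using mp by (simp add: N_def)
  let ?T = "pole_term_int m p k"
  have cong: "?T j' = ?T j" if "N dvd j' - j" for j j'
    using that pole_term_int_cong[OF mp(1,2)] unfolding N_def by blast
  have cmod: "?T (j mod N) = ?T j" for j
    by (rule cong) (simp add: mod_eq_dvd_iff[symmetric])
  obtain u where u: "\<And>j. ?T (u * j) = - ?T j" and "int (4 * m * p) dvd u\<^sup>2 - 1"
    using pole_term_int_reflect[OF mp] by metis
  then have u2: "N dvd u\<^sup>2 - 1" unfolding N_def by (auto simp: dvd_def)
  have inv: "u * (u * j mod N) mod N = j" if "j \<in> {0..<N}" for j
  proof -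
    have "u * (u * j mod N) mod N = u * (u * j) mod N" by (simp add: mod_mult_right_eq)
    also have "\<dots> = j mod N"
      using dvd_mult2[OF u2, of j] by (simp add: mod_eq_dvd_iff power2_eq_square algebra_simps)
    finally show ?thesis using that by simp
  qed
  have "(\<Sum>j\<in>{0..<N}. ?T j) = (\<Sum>j\<in>{0..<N}. ?T (u * j mod N))"
    by (rule sum.reindex_bij_witness[of _ "\<lambda>j. u * j mod N" "\<lambda>j. u * j mod N"]) (use N inv in auto)
  also have "\<dots> = - (\<Sum>j\<in>{0..<N}. ?T j)" by (simp add: cmod u sum_negf)
  finally have zero: "(\<Sum>j\<in>{0..<N}. ?T j) = 0" by simp
  define a where "a = int (m * p)"
  have a: "a > 0" "N = 2 * a" using mp by (simp_all add: a_def N_def)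
  have T0: "?T 0 = 0" by (simp add: pole_term_int_def)
  have Ta: "?T a = 0"
    using mp by (simp add: pole_term_int_def a_def)
  have refl: "?T (N - j) = ?T j" for j
  proof -
    have "?T (N - j) = ?T (- j)" by (rule cong) simp
    also have "\<dots> = ?T j" by (simp add: pole_term_int_def)
    finally show ?thesis .
  qed
  have split: "{0..<N} = insert 0 (insert a ({1..<a} \<union> {a + 1..<N}))" using a by auto
  have "(\<Sum>j\<in>{0..<N}. ?T j) = (\<Sum>j\<in>{1..<a}. ?T j) + (\<Sum>j\<in>{a + 1..<N}. ?T j)"
    unfolding split using a by (simp add: T0 Ta sum.union_disjoint)
  also have "(\<Sum>j\<in>{a + 1..<N}. ?T j) = (\<Sum>j\<in>{1..<a}. ?T j)"
    by (rule sum.reindex_bij_witness[of _ "\<lambda>j. N - j" "\<lambda>j. N - j"]) (use a refl in auto)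
  finally have "(\<Sum>j\<in>{1..<a}. ?T j) = 0" using zero by simp
  moreover have "(\<Sum>j\<in>{1..<a}. ?T j) = (\<Sum>j=1..<m * p. ?T (int j))"
    by (rule sum.reindex_bij_witness[of _ int nat]) (auto simp: a_def nat_less_iff simp flip: of_nat_mult)
  ultimately show ?thesis
    by (simp add: pole_sum_def pole_term_int_of_nat)
qed

lemma pole_sum_periodic:
  assumes "m > 0" "p > 0"
  shows "pole_sum m p n (k + 4 * m * p) = pole_sum m p n k"
proof -
  have "pole_term m p (k + 4 * m * p) j = pole_term m p k j" for j
  proof -
    have "(-1 :: complex) ^ (j * (k + 4 * m * p + 1)) = (-1) ^ (j * (k + 1))"
      by (simp add: minus_one_power_iff)
    moreover have "- (pi * \<i> * of_real (real (k + 4 * m * p) * real j ^ 2 / (2 * (real m * real p))))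
       = - (pi * \<i> * of_real (real k * real j ^ 2 / (2 * (real m * real p)))) + pi * \<i> * (2 * of_int (- (int j ^ 2)))"
      using assms by (simp add: field_simps)
    ultimately show ?thesis
      unfolding pole_term_def by (simp only: exp_add exp_pi_i_int_even mult_1_right)
  qed
  then show ?thesis by (simp add: pole_sum_def)
qed

lemma finite_range_pole_sum:
  assumes "m > 0" "p > 0"
  shows "finite (range (pole_sum m p n))"
proof -
  let ?N = "4 * m * p"
  have "pole_sum m p n (r + q * ?N) = pole_sum m p n r" for q r
  proof (induction q)
    case (Suc q)
    have "r + Suc q * ?N = (r + q * ?N) + 4 * m * p" by (simp add: algebra_simps)
    then show ?case using Suc by (simp only: pole_sum_periodic[OF assms])
  qed simp
  then have "pole_sum m p n k = pole_sum m p n (k mod ?N)" for k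
    by (metis mod_mult_div_eq mult.commute add.commute mod_div_mult_eq)
  then have "range (pole_sum m p n) \<subseteq> pole_sum m p n ` {..<?N}"
    using assms by (auto intro!: image_eqI[of _ _ "_ mod ?N"])
  then show ?thesis using finite_subset by blast
qed

section \<open>Asymptotics at the saddle point\<close>

lemma kernel_moment_rescale:
  assumes r: "r > 0"
  shows "of_real (r ^ 3) * kernel_moment m p (r\<^sup>2)
     = (\<integral>u. of_real (u * exp (- u\<^sup>2)) * (of_real r * torus_kernel m p (slant * of_real (u / r))) \<partial>lborel)"
proof -
  have "kernel_moment m p (r\<^sup>2) = \<bar>1 / r\<bar> *\<^sub>R (\<integral>u. of_real (0 + 1 / r * u) * exp (- of_real (r\<^sup>2 * (0 + 1 / r * u)\<^sup>2))
      * torus_kernel m p (slant * of_real (0 + 1 / r * u)) \<partial>lborel)"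
    unfolding kernel_moment_def by (rule lborel_integral_real_affine) (use r in simp)
  also have "(\<lambda>u. of_real (0 + 1 / r * u) * exp (- of_real (r\<^sup>2 * (0 + 1 / r * u)\<^sup>2))
      * torus_kernel m p (slant * of_real (0 + 1 / r * u)))
    = (\<lambda>u. of_real (1 / r\<^sup>2) * (of_real (u * exp (- u\<^sup>2)) * (of_real r * torus_kernel m p (slant * of_real (u / r)))))"
    using r by (intro ext) (simp add: power_divide power2_eq_square exp_of_real[symmetric] mult_ac)
  also have "\<bar>1 / r\<bar> *\<^sub>R integral\<^sup>L lborel \<dots> = of_real (1 / r) * (of_real (1 / r\<^sup>2) *
      (\<integral>u. of_real (u * exp (- u\<^sup>2)) * (of_real r * torus_kernel m p (slant * of_real (u / r))) \<partial>lborel))"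
    unfolding integral_mult_right_zero using r by (simp add: scaleR_conv_of_real)
  finally show ?thesis using r by (simp add: power3_eq_cube power2_eq_square)
qed

text \<open>
  After the substitution \<open>t = u / r\<close> the integrand tends to \<open>\<omega> \<pi> u\<^sup>2 exp (- u\<^sup>2)\<close>, because the kernel has
  derivative \<open>\<pi>\<close> at 0.
\<close>

lemma tendsto_kernel_moment:
  assumes mp: "m > 0" "p > 0"
  shows "((\<lambda>r. of_real (r ^ 3) * kernel_moment m p (r\<^sup>2)) \<longlongrightarrow> slant * of_real (pi * (sqrt pi / 2))) at_top"
proof -
  define s where "s r u = of_real (u * exp (- u\<^sup>2)) * (of_real r * torus_kernel m p (slant * of_real (u / r)))" for r u :: real
  define f where "f u = slant * of_real (pi * (u\<^sup>2 * exp (- u\<^sup>2)))" for u :: real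
  define A where "A = pi * (m + p) + 2"
  define w where "w u = 2 * pi * exp ((A + 1)\<^sup>2 / 4) * exp (- \<bar>u\<bar>)" for u :: real
  have lim: "((\<lambda>r. \<integral>u. s r u \<partial>lborel) \<longlongrightarrow> (\<integral>u. f u \<partial>lborel)) at_top"
  proof (rule integral_dominated_convergence_at_top)
    show "f \<in> borel_measurable lborel"
      unfolding f_def by measurable
    show "s r \<in> borel_measurable lborel" for r
    proof -
      have "(\<lambda>u. sin (of_real c * (slant * of_real (u / r)))) \<in> borel_measurable lborel" for c :: real
      proof -
        have "continuous_on UNIV (\<lambda>u. sin (of_real c * (slant * of_real (u / r))))"
          unfolding divide_inverse by (intro continuous_intros)
        then show ?thesis using borel_measurable_continuous_onI by simp
      qed
      then show ?thesis
        unfolding s_def torus_kernel_def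
        by (intro borel_measurable_times borel_measurable_divide) auto
    qed
    show "integrable lborel w"
      unfolding w_def using integrable_exp_neg_abs by simp
    show "AE u in lborel. ((\<lambda>r. s r u) \<longlongrightarrow> f u) at_top"
    proof (intro AE_I2)
      fix u :: real
      show "((\<lambda>r. s r u) \<longlongrightarrow> f u) at_top"
      proof (cases "u = 0")
        case True
        then show ?thesis by (simp add: s_def f_def)
      next
        case False
        have "((\<lambda>r. u / r) \<longlongrightarrow> 0) at_top" by real_asymp
        then have "((\<lambda>r. slant * of_real (u / r)) \<longlongrightarrow> slant * of_real 0) at_top"
          by (intro tendsto_intros)
        moreover have "\<forall>\<^sub>F r in at_top. slant * of_real (u / r) \<noteq> 0"
          using eventually_gt_at_top[of 0] by (rule eventually_mono) (use False in auto)
        ultimately have "filterlim (\<lambda>r. slant * of_real (u / r)) (at 0) at_top"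
          by (simp add: filterlim_at)
        from filterlim_compose[OF tendsto_torus_kernel_over_self[OF mp] this]
        have "((\<lambda>r. torus_kernel m p (slant * of_real (u / r)) / (slant * of_real (u / r))) \<longlongrightarrow> of_real pi) at_top" .
        then have lim: "((\<lambda>r. of_real (u * exp (- u\<^sup>2)) * (slant * of_real u * (torus_kernel m p (slant * of_real (u / r)) / (slant * of_real (u / r)))))
            \<longlongrightarrow> of_real (u * exp (- u\<^sup>2)) * (slant * of_real u * of_real pi)) at_top"
          by (intro tendsto_mult tendsto_const)
        have fu: "of_real (u * exp (- u\<^sup>2)) * (slant * of_real u * of_real pi) = f u"
          by (simp add: f_def power2_eq_square)
        have ev: "\<forall>\<^sub>F r in at_top. of_real (u * exp (- u\<^sup>2)) * (slant * of_real u * (torus_kernel m p (slant * of_real (u / r)) / (slant * of_real (u / r)))) = s r u"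
          using eventually_gt_at_top[of 0] by (rule eventually_mono) (use False in \<open>simp add: s_def\<close>)
        show ?thesis using Lim_transform_eventually[OF lim ev] unfolding fu .
      qed
    qed
    show "\<forall>\<^sub>F r in at_top. AE u in lborel. norm (s r u) \<le> w u"
      using eventually_ge_at_top[of 1]
    proof (rule eventually_mono, intro AE_I2)
      fix r u :: real assume r: "1 \<le> r"
      define q where "q = \<bar>u / r\<bar>"
      have q: "0 \<le> q" "r * q = \<bar>u\<bar>" using r by (simp_all add: q_def abs_divide)
      have ur: "q \<le> \<bar>u\<bar>" using mult_right_mono[OF r q(1)] q(2) by simp
      have "norm (torus_kernel m p (slant * of_real (u / r))) \<le> 2 * pi * q * exp (pi * (m + p) * q)"
        unfolding q_def by (rule norm_torus_kernel_slant_le[OF mp])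
      also have "\<dots> \<le> 2 * pi * q * exp (pi * (m + p) * \<bar>u\<bar>)"
        using q(1) ur by (intro mult_left_mono exp_le_cancel_iff[THEN iffD2]) auto
      finally have "r * norm (torus_kernel m p (slant * of_real (u / r))) \<le> r * (2 * pi * q * exp (pi * (m + p) * \<bar>u\<bar>))"
        using r by (intro mult_left_mono) auto
      also have "\<dots> = 2 * pi * \<bar>u\<bar> * exp (pi * (m + p) * \<bar>u\<bar>)" unfolding q(2)[symmetric] by simp
      finally have "\<bar>u\<bar> * exp (- u\<^sup>2) * (r * norm (torus_kernel m p (slant * of_real (u / r))))
          \<le> \<bar>u\<bar> * exp (- u\<^sup>2) * (2 * pi * \<bar>u\<bar> * exp (pi * (m + p) * \<bar>u\<bar>))"
        by (intro mult_left_mono) auto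
      moreover have "norm (s r u) = \<bar>u\<bar> * exp (- u\<^sup>2) * (r * norm (torus_kernel m p (slant * of_real (u / r))))"
        unfolding s_def norm_mult norm_of_real abs_mult abs_exp_cancel using r by simp
      ultimately have "norm (s r u) \<le> \<bar>u\<bar> * exp (- u\<^sup>2) * (2 * pi * \<bar>u\<bar> * exp (pi * (m + p) * \<bar>u\<bar>))"
        by (simp only:)
      also have "\<dots> = 2 * pi * (\<bar>u\<bar> ^ 2 * (exp (- u\<^sup>2) * exp (pi * (m + p) * \<bar>u\<bar>)))"
        by (simp only: power2_eq_square mult_ac)
      also have "\<dots> \<le> 2 * pi * (exp (2 * \<bar>u\<bar>) * (exp (- u\<^sup>2) * exp (pi * (m + p) * \<bar>u\<bar>)))"
        using power_le_exp_mult[of "\<bar>u\<bar>" 2] by (intro mult_left_mono mult_right_mono) auto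
      also have "exp (2 * \<bar>u\<bar>) * (exp (- u\<^sup>2) * exp (pi * (m + p) * \<bar>u\<bar>)) = exp (- 1 * u\<^sup>2 + A * \<bar>u\<bar>)"
        unfolding exp_add[symmetric] A_def by (rule arg_cong[of _ _ exp]) (simp add: algebra_simps)
      also have "2 * pi * exp (- 1 * u\<^sup>2 + A * \<bar>u\<bar>) \<le> 2 * pi * exp ((A + 1)\<^sup>2 / (4 * 1) - \<bar>u\<bar>)"
        using neg_quadratic_le_neg_abs[of 1 u A] by (intro mult_left_mono exp_le_cancel_iff[THEN iffD2]) auto
      also have "\<dots> = 2 * pi * (exp ((A + 1)\<^sup>2 / 4) * exp (- \<bar>u\<bar>))" unfolding exp_add[symmetric] by simp
      also have "\<dots> = w u" by (simp only: w_def mult.assoc)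
      finally show "norm (s r u) \<le> w u" .
    qed
  qed
  have f: "(\<integral>u. f u \<partial>lborel) = slant * of_real (pi * (sqrt pi / 2))"
  proof -
    have "has_bochner_integral lborel (\<lambda>u. slant * complex_of_real (pi * (u\<^sup>2 * exp (- 1 * u\<^sup>2)))) (slant * of_real (pi * (sqrt (pi / 1) / (2 * 1))))"
      by (intro has_bochner_integral_mult_right has_bochner_integral_of_real has_bochner_integral_gaussian_moment) simp
    from has_bochner_integral_integral_eq[OF this] show ?thesis unfolding f_def by simp
  qed
  have ev: "\<forall>\<^sub>F r in at_top. (\<integral>u. s r u \<partial>lborel) = of_real (r ^ 3) * kernel_moment m p (r\<^sup>2)"
    using eventually_gt_at_top[of 0] by (rule eventually_mono) (simp only: s_def kernel_moment_rescale)
  show ?thesis using Lim_transform_eventually[OF lim ev] unfolding f .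
qed

lemma sinh_of_nat_mult_eq_0:
  fixes z :: complex
  assumes "sinh z = 0"
  shows "sinh (of_nat k * z) = 0"
  by (induction k) (simp_all add: distrib_right sinh_add assms)

text \<open>
  The unknot factor cancels, and both \<open>torus_knot_sum\<close> and \<open>2 sinh (k h / 2)\<close> have a zero at the
  specialization point, so the limit is the quotient of their derivatives.
\<close>

lemma jones_ratio_tendsto:
  assumes k: "k > 0" and F: "((torus_knot_sum m p k) has_field_derivative F') (at (spec_point k))"
    and zero: "torus_knot_sum m p k (spec_point k) = 0"
  shows "(jones_ratio m p k \<longlongrightarrow> - F' / of_nat k) (at (spec_point k))"
proof -
  define h0 where "h0 = spec_point k"
  define N where "N h = 2 * sinh (of_nat k * h / 2)" for h :: complex
  have kh0: "of_nat k * h0 / 2 = \<i> * of_real pi" using k by (simp add: h0_def spec_point_def)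
  have N0: "N h0 = 0" unfolding N_def kh0 by (simp add: sinh_conv_sin)
  have "(N has_field_derivative of_nat k * cosh (of_nat k * h0 / 2)) (at h0)"
    unfolding N_def by (auto intro!: derivative_eq_intros)
  also have "cosh (of_nat k * h0 / 2) = -1" unfolding kh0 by (simp add: cosh_conv_cos)
  finally have "((\<lambda>h. N h / (h - h0)) \<longlongrightarrow> - of_nat k) (at h0)"
    by (simp add: has_field_derivative_iff N0)
  note N = this
  have "((\<lambda>h. torus_knot_sum m p k h / (h - h0)) \<longlongrightarrow> F') (at h0)"
    using F zero by (simp add: has_field_derivative_iff h0_def)
  from tendsto_divide[OF this N] k
  have lim: "((\<lambda>h. torus_knot_sum m p k h / (h - h0) / (N h / (h - h0))) \<longlongrightarrow> - F' / of_nat k) (at h0)" by simp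
  have "\<forall>\<^sub>F h in at h0. N h / (h - h0) \<noteq> 0"
    by (rule tendsto_imp_eventually_ne[OF N]) (use k in simp)
  then have "\<forall>\<^sub>F h in at h0. torus_knot_sum m p k h / (h - h0) / (N h / (h - h0)) = jones_ratio m p k h"
  proof (rule eventually_mono)
    fix h assume "N h / (h - h0) \<noteq> 0"
    then have nz: "N h \<noteq> 0" "h - h0 \<noteq> 0" by auto
    have "sinh (of_nat k * h / 2) \<noteq> 0" using nz(1) by (simp add: N_def)
    moreover have "sinh (h / 2) \<noteq> 0"
      using nz(1) sinh_of_nat_mult_eq_0[of "h / 2" k] by (auto simp: N_def)
    ultimately show "torus_knot_sum m p k h / (h - h0) / (N h / (h - h0)) = jones_ratio m p k h"
      using nz by (simp add: jones_ratio_def colored_jones_torus_def colored_jones_unknot_def N_def)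
  qed
  from Lim_transform_eventually[OF lim this] show ?thesis unfolding h0_def .
qed

section \<open>The Gauss sum and the hyperbolic specification\<close>

definition gauss_moment :: "nat \<Rightarrow> nat \<Rightarrow> nat \<Rightarrow> nat \<Rightarrow> complex" where
  "gauss_moment m p k n = (\<Sum>j<k. \<Sum>\<epsilon>\<in>{1, -1}. of_real (\<epsilon> * gauss_node m p k \<epsilon> j ^ n)
     * exp (2 * pi * \<i> * of_real (real (m * p) * (gauss_node m p k \<epsilon> j)\<^sup>2 / real k)))"

lemma gauss_moment_0_eq_0:
  assumes mp: "m > 0" "p > 0" "coprime m p" and k: "k > 0"
  shows "gauss_moment m p k 0 = 0"
proof -
  have a0: "real (m * p) > 0" and k0: "real k > 0" using mp k by simp_all
  define C where "C = complex_of_real (sqrt (pi / (pi * real (m * p) * real k / 2)))"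
  have C: "C \<noteq> 0" using mp k unfolding C_def by simp
  have "C * gauss_moment m p k 0 = (\<Sum>j<k. \<Sum>\<epsilon>\<in>{1, -1}. of_real \<epsilon> * (\<integral>t. slant_wave 0 (real (m * p)) k (gauss_node m p k \<epsilon> j) t \<partial>lborel))"
    unfolding slant_wave_integral(2)[OF a0 k0] C_def[symmetric] gauss_moment_def sum_distrib_left
    by (intro sum.cong refl) (simp add: mult_ac)
  also have "\<dots> = 0"
    unfolding sum_slant_wave_integral[OF mp even_zero k] torus_integrand_integral(1)[OF mp k] pole_sum_0_eq_0[OF mp] by simp
  finally show ?thesis using C by simp
qed

text \<open>
  The integral of \<open>slant_wave 2\<close> yields \<open>4 x\<^sup>2 / k\<^sup>2\<close> plus a constant.  The constant is harmless because the
  unweighted Gauss sum vanishes.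
\<close>

lemma norm_gauss_moment_2:
  assumes mp: "m > 0" "p > 0" "coprime m p" and k: "k > 0"
  defines "\<kappa> \<equiv> pi * real (m * p) * real k / 2"
  shows "norm (gauss_moment m p k 2) = (real k)\<^sup>2 * sqrt (real (m * p) * real k / 2)
     * norm (kernel_moment m p \<kappa> + exp (- (\<i> * of_real \<kappa>)) / of_nat (m * p) * pole_sum m p 2 k)"
proof -
  have a0: "real (m * p) > 0" and k0: "real k > 0" using mp k by simp_all
  define c where "c = sqrt (pi / \<kappa>)"
  define I where "I = (\<integral>t. torus_integrand m p 2 \<kappa> (slant * of_real t) \<partial>lborel)"
  define R where "R = kernel_moment m p \<kappa> + exp (- (\<i> * of_real \<kappa>)) / of_nat (m * p) * pole_sum m p 2 k"
  have c: "c > 0" using mp k by (simp add: c_def \<kappa>_def)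
  have ci: "1 / c = sqrt (real (m * p) * real k / 2)"
    using mp k by (simp add: c_def \<kappa>_def real_sqrt_divide)
  have "of_real c * (of_real (4 / (real k)\<^sup>2) * gauss_moment m p k 2 - \<i> / of_real (2 * \<kappa>) * gauss_moment m p k 0)
     = (\<Sum>j<k. \<Sum>\<epsilon>\<in>{1, -1}. of_real \<epsilon> * (\<integral>t. slant_wave 2 (real (m * p)) k (gauss_node m p k \<epsilon> j) t \<partial>lborel))"
    unfolding slant_wave_integral(3)[OF a0 k0] c_def \<kappa>_def[symmetric] gauss_moment_def sum_distrib_left sum_subtractf[symmetric]
    by (intro sum.cong refl) (simp add: algebra_simps)
  also have "\<dots> = 2 * \<i> * I"
    unfolding I_def \<kappa>_def by (rule sum_slant_wave_integral[OF mp _ k]) simp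
  finally have "of_real c * (of_real (4 / (real k)\<^sup>2) * gauss_moment m p k 2) = 2 * \<i> * I"
    by (simp add: gauss_moment_0_eq_0[OF mp k])
  then have "norm (of_real c * (of_real (4 / (real k)\<^sup>2) * gauss_moment m p k 2)) = norm (2 * \<i> * I)" by (rule arg_cong)
  then have "c * (4 / (real k)\<^sup>2 * norm (gauss_moment m p k 2)) = 2 * norm I"
    using c by (simp add: norm_mult norm_divide norm_power)
  then have "norm (gauss_moment m p k 2) = (real k)\<^sup>2 * (1 / c) * (norm I / 2)"
    using c k0 by (simp add: field_simps)
  moreover have "norm I = 2 * norm R"
  proof -
    have u: "exp (\<i> * of_real \<kappa>) * exp (- (\<i> * of_real \<kappa>)) = 1" by (simp flip: exp_add)
    have "1 / slant = \<i> * slant" using slant_square by (simp add: field_simps power2_eq_square)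
    have "I = - 2 * slant * exp (\<i> * of_real \<kappa>) * kernel_moment m p \<kappa> + 2 * \<i> / (of_nat (m * p) * slant) * pole_sum m p 2 k"
      unfolding I_def \<kappa>_def by (rule torus_integrand_integral(2)[OF mp k])
    also have "2 * \<i> / (of_nat (m * p) * slant) = 2 * \<i> * (1 / slant) / of_nat (m * p)" by simp
    also have "\<dots> = - 2 * slant * (exp (\<i> * of_real \<kappa>) * exp (- (\<i> * of_real \<kappa>))) / of_nat (m * p)"
      unfolding u \<open>1 / slant = \<i> * slant\<close> by (simp add: algebra_simps)
    finally have "I = - 2 * slant * exp (\<i> * of_real \<kappa>) * R"
      unfolding R_def by (simp add: algebra_simps)
    then show ?thesis by (simp add: norm_mult)
  qed
  ultimately show ?thesis unfolding R_def ci by simp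
qed

lemma torus_knot_sum_eq:
  assumes mp: "m > 0" "p > 0"
  defines "\<mu> \<equiv> ((real m)\<^sup>2 + (real p)\<^sup>2) / (4 * real (m * p))"
  shows "torus_knot_sum m p k h = (\<Sum>j<k. \<Sum>\<epsilon>\<in>{1, -1}.
     of_real \<epsilon> * exp (h * of_real (real (m * p) * (gauss_node m p k \<epsilon> j)\<^sup>2 - \<mu>)))"
proof -
  have expo: "h * of_nat m * of_nat p * (of_nat j - (of_nat k - 1) / 2) ^ 2
      + h * (of_nat j - (of_nat k - 1) / 2) * (of_nat m + of_real \<epsilon> * of_nat p) + of_real \<epsilon> * h / 2
    = h * of_real (real (m * p) * (gauss_node m p k \<epsilon> j)\<^sup>2 - \<mu>)" if \<epsilon>: "\<epsilon>\<^sup>2 = 1" for j \<epsilon>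
  proof -
    define r where "r = real j - (real k - 1) / 2"
    have "real (m * p) * (r + 1 / (2 * p) + \<epsilon> / (2 * m))\<^sup>2 = m * p * r\<^sup>2 + r * (m + \<epsilon> * p) + (m\<^sup>2 + p\<^sup>2 * \<epsilon>\<^sup>2) / (4 * real (m * p)) + \<epsilon> / 2"
      using mp by (simp add: field_simps power2_eq_square)
    then have A: "real (m * p) * (gauss_node m p k \<epsilon> j)\<^sup>2 - \<mu> = m * p * r\<^sup>2 + r * (m + \<epsilon> * p) + \<epsilon> / 2"
      unfolding gauss_node_def r_def[symmetric] \<epsilon> \<mu>_def by simp
    have r: "of_nat j - (of_nat k - 1) / 2 = complex_of_real r" by (simp add: r_def)
    show ?thesis unfolding A r by (simp add: algebra_simps)
  qed
  show ?thesis
    unfolding torus_knot_sum_def Let_def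
    using expo[of 1] expo[of "-1"] by (simp add: sum.distrib sum_subtractf sum_negf)
qed

lemma torus_knot_sum_at_spec_point:
  assumes mp: "m > 0" "p > 0" "coprime m p" and k: "k > 0"
  shows "torus_knot_sum m p k (spec_point k) = 0"
    and "\<exists>w. norm w = 1 \<and> ((torus_knot_sum m p k) has_field_derivative
       w * of_nat (m * p) * gauss_moment m p k 2) (at (spec_point k))"
proof -
  define \<mu> where "\<mu> = ((real m)\<^sup>2 + (real p)\<^sup>2) / (4 * real (m * p))"
  define w where "w = exp (- (2 * pi * \<i> * of_real (\<mu> / real k)))"
  define a where "a = real (m * p)"
  note eq = torus_knot_sum_eq[OF mp(1,2), folded \<mu>_def]
  have ex: "exp (spec_point k * of_real (a * x\<^sup>2 - \<mu>)) = w * exp (2 * pi * \<i> * of_real (a * x\<^sup>2 / real k))" for x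
    unfolding w_def exp_add[symmetric] using k by (simp add: spec_point_def field_simps)
  have "torus_knot_sum m p k (spec_point k) = w * gauss_moment m p k 0"
    unfolding eq a_def[symmetric] ex gauss_moment_def sum_distrib_left
    by (intro sum.cong refl) (simp add: a_def mult_ac)
  then show "torus_knot_sum m p k (spec_point k) = 0" by (simp add: gauss_moment_0_eq_0[OF mp k])
  have "((\<lambda>h. \<Sum>j<k. \<Sum>\<epsilon>\<in>{1, -1}. of_real \<epsilon> * exp (h * of_real (a * (gauss_node m p k \<epsilon> j)\<^sup>2 - \<mu>)))
    has_field_derivative (\<Sum>j<k. \<Sum>\<epsilon>\<in>{1, -1}. of_real \<epsilon> * (exp (spec_point k * of_real (a * (gauss_node m p k \<epsilon> j)\<^sup>2 - \<mu>))
       * of_real (a * (gauss_node m p k \<epsilon> j)\<^sup>2 - \<mu>)))) (at (spec_point k))"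
    by (intro DERIV_sum) (auto intro!: derivative_eq_intros)
  also have "(\<Sum>j<k. \<Sum>\<epsilon>\<in>{1, -1}. of_real \<epsilon> * (exp (spec_point k * of_real (a * (gauss_node m p k \<epsilon> j)\<^sup>2 - \<mu>))
       * of_real (a * (gauss_node m p k \<epsilon> j)\<^sup>2 - \<mu>))) = w * of_real a * gauss_moment m p k 2 - w * of_real \<mu> * gauss_moment m p k 0"
    unfolding ex gauss_moment_def sum_distrib_left sum_subtractf[symmetric]
    by (intro sum.cong refl) (simp add: a_def algebra_simps)
  finally have "((torus_knot_sum m p k) has_field_derivative w * of_nat (m * p) * gauss_moment m p k 2) (at (spec_point k))"
    unfolding eq[abs_def] a_def by (simp add: gauss_moment_0_eq_0[OF mp k])
  moreover have "norm w = 1" by (simp add: w_def)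
  ultimately show "\<exists>w. norm w = 1 \<and> ((torus_knot_sum m p k) has_field_derivative
       w * of_nat (m * p) * gauss_moment m p k 2) (at (spec_point k))" by blast
qed

lemma hyperbolic_spec_limit:
  assumes mp: "m > 0" "p > 0" "coprime m p" and k: "k > 0"
  shows "(jones_ratio m p k \<longlongrightarrow> hyperbolic_spec m p k) (at (spec_point k))"
    and "norm (hyperbolic_spec m p k) = real (m * p) / real k * norm (gauss_moment m p k 2)"
proof -
  obtain w where w: "norm w = 1" "((torus_knot_sum m p k) has_field_derivative
       w * of_nat (m * p) * gauss_moment m p k 2) (at (spec_point k))"
    using torus_knot_sum_at_spec_point(2)[OF mp k] by blast
  note lim = jones_ratio_tendsto[OF k w(2) torus_knot_sum_at_spec_point(1)[OF mp k]]
  then have eq: "hyperbolic_spec m p k = - (w * of_nat (m * p) * gauss_moment m p k 2) / of_nat k"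
    unfolding hyperbolic_spec_def by (rule tendsto_Lim[OF trivial_limit_at])
  show "(jones_ratio m p k \<longlongrightarrow> hyperbolic_spec m p k) (at (spec_point k))"
    unfolding eq by (rule lim)
  show "norm (hyperbolic_spec m p k) = real (m * p) / real k * norm (gauss_moment m p k 2)"
    unfolding eq by (simp add: norm_mult norm_divide w(1))
qed

lemma norm_hyperbolic_spec:
  assumes mp: "m > 0" "p > 0" "coprime m p" and k: "k > 0"
  defines "r \<equiv> sqrt (pi * real (m * p) * real k / 2)"
  shows "norm (hyperbolic_spec m p k) = 2 / (pi * sqrt pi) * norm (of_real (r ^ 3) * kernel_moment m p (r\<^sup>2)
     + of_real (r ^ 3) * (exp (- (\<i> * of_real (r\<^sup>2))) / of_nat (m * p)) * pole_sum m p 2 k)"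
proof -
  define a where "a = real (m * p)"
  have a0: "a > 0" and k0: "real k > 0" using mp k by (simp_all add: a_def)
  have r2: "r\<^sup>2 = pi * a * real k / 2" using a0 by (simp add: r_def a_def)
  have r0: "r > 0" using mp k by (simp add: r_def)
  have "sqrt (a * real k / 2) = sqrt (r\<^sup>2 / pi)" by (simp add: r2)
  also have "\<dots> = r / sqrt pi" using r0 by (simp add: real_sqrt_divide)
  finally have s: "sqrt (a * real k / 2) = r / sqrt pi" .
  have "a * real k = 2 * r\<^sup>2 / pi" by (simp add: r2)
  then have "a / real k * (real k)\<^sup>2 * (r / sqrt pi) = 2 / (pi * sqrt pi) * r ^ 3"
    using k0 by (simp add: power2_eq_square power3_eq_cube)
  then have "norm (hyperbolic_spec m p k) = 2 / (pi * sqrt pi) * (r ^ 3 * norm (kernel_moment m p (r\<^sup>2)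
      + exp (- (\<i> * of_real (r\<^sup>2))) / of_nat (m * p) * pole_sum m p 2 k))"
    unfolding hyperbolic_spec_limit(2)[OF mp k] norm_gauss_moment_2[OF mp k] r2 a_def[symmetric] s
    by (simp only: mult.assoc[symmetric])
  also have "r ^ 3 * norm (kernel_moment m p (r\<^sup>2) + exp (- (\<i> * of_real (r\<^sup>2))) / of_nat (m * p) * pole_sum m p 2 k)
     = norm (of_real (r ^ 3) * (kernel_moment m p (r\<^sup>2) + exp (- (\<i> * of_real (r\<^sup>2))) / of_nat (m * p) * pole_sum m p 2 k))"
    using r0 by (simp add: norm_mult norm_power)
  finally show ?thesis by (simp only: distrib_left mult.assoc)
qed

text \<open>
  The two contributions compete only through whether the periodic residue sum vanishes at \<open>k\<close>: if it does, the
  saddle point alone gives modulus close to 1; if not, the residues grow like \<open>k\<^bsup>3/2\<^esup>\<close>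
  while the saddle point stays bounded.
\<close>

lemma hyperbolic_spec_bounds:
  assumes mp: "m > 0" "p > 0" "coprime m p"
  obtains B where "B > 0" "\<forall>\<^sub>F k in sequentially. 1 / 2 \<le> norm (hyperbolic_spec m p k) \<and> norm (hyperbolic_spec m p k) \<le> 2 + B * (real k)\<^sup>2"
proof -
  define a where "a = real (m * p)"
  define c where "c = pi * sqrt pi / 2"
  define r where "r k = sqrt (pi * a * real k / 2)" for k :: nat
  define z where "z k = of_real (r k ^ 3) * kernel_moment m p ((r k)\<^sup>2)" for k
  define y where "y k = of_real (r k ^ 3) * (exp (- (\<i> * of_real ((r k)\<^sup>2))) / of_nat (m * p)) * pole_sum m p 2 k" for k
  have a0: "a > 0" using mp by (simp add: a_def)
  have c0: "c > 0" by (simp add: c_def)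
  have spec: "norm (hyperbolic_spec m p k) = norm (z k + y k) / c" if "k > 0" for k
    using norm_hyperbolic_spec[OF mp that] by (simp add: z_def y_def r_def a_def c_def)
  have rtop: "filterlim r at_top sequentially"
    unfolding r_def using a0 by real_asymp
  have "z \<longlonglongrightarrow> slant * of_real (pi * (sqrt pi / 2))"
    unfolding z_def by (rule filterlim_compose[OF tendsto_kernel_moment[OF mp(1,2)] rtop])
  then have "(\<lambda>k. norm (z k)) \<longlonglongrightarrow> norm (slant * of_real (pi * (sqrt pi / 2)))" by (rule tendsto_norm)
  then have zlim: "(\<lambda>k. norm (z k)) \<longlonglongrightarrow> c" by (simp add: norm_mult c_def)
  have ny: "norm (y k) = r k ^ 3 / a * norm (pole_sum m p 2 k)" for k
  proof -
    have "r k \<ge> 0" using a0 by (simp add: r_def)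
    then show ?thesis by (simp add: y_def norm_mult norm_divide norm_power a_def)
  qed
  have fin: "finite (range (pole_sum m p 2))" by (rule finite_range_pole_sum[OF mp(1,2)])
  define D where "D = Max (norm ` range (pole_sum m p 2))"
  have D: "norm (pole_sum m p 2 k) \<le> D" for k
    unfolding D_def using fin by (intro Max_ge) auto
  have D0: "D \<ge> 0" using D[of 0] norm_ge_zero order_trans by blast
  \<comment> \<open>The element 1 makes the set nonempty when all residue sums vanish.\<close>
  define \<delta> where "\<delta> = Min (insert 1 (norm ` (range (pole_sum m p 2) - {0})))"
  have \<delta>0: "\<delta> > 0" unfolding \<delta>_def using fin by (subst Min_gr_iff) auto
  have \<delta>: "norm (pole_sum m p 2 k) \<ge> \<delta>" if "pole_sum m p 2 k \<noteq> 0" for k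
    unfolding \<delta>_def using fin that by (intro Min_le) auto
  \<comment> \<open>The residue term has modulus at most \<open>(r k)\<^sup>3 D / a\<close>, and \<open>(r k)\<^sup>3 \<le> (r k)\<^sup>4 = (\<pi> a k / 2)\<^sup>2\<close>;
    the summand 1 only makes \<open>B\<close> positive.\<close>
  define B where "B = (pi * a / 2)\<^sup>2 / a * D / c + 1"
  have B0: "B > 0" using a0 c0 D0 by (simp add: B_def add_nonneg_pos)
  have "\<forall>\<^sub>F k in sequentially. norm (z k) > c / 2"
    using order_tendstoD(1)[OF zlim, of "c / 2"] c0 by simp
  moreover have "\<forall>\<^sub>F k in sequentially. norm (z k) < 2 * c"
    using order_tendstoD(2)[OF zlim, of "2 * c"] c0 by simp
  moreover have "\<forall>\<^sub>F k in sequentially. r k ^ 3 * (\<delta> / a) \<ge> 4 * c"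
  proof -
    have "filterlim (\<lambda>k. r k ^ 3 * (\<delta> / a)) at_top sequentially"
      unfolding r_def using a0 \<delta>0 by real_asymp
    then show ?thesis by (simp add: filterlim_at_top)
  qed
  moreover have "\<forall>\<^sub>F k in sequentially. r k \<ge> 1"
    using rtop by (simp add: filterlim_at_top)
  moreover have "\<forall>\<^sub>F k in sequentially. k > (0::nat)" by (rule eventually_gt_at_top)
  ultimately have "\<forall>\<^sub>F k in sequentially. 1 / 2 \<le> norm (hyperbolic_spec m p k) \<and> norm (hyperbolic_spec m p k) \<le> 2 + B * (real k)\<^sup>2"
  proof eventually_elim
    case (elim k)
    have "c / 2 \<le> norm (z k + y k)"
    proof (cases "pole_sum m p 2 k = 0")
      case True
      then have "y k = 0" by (simp add: y_def)
      then show ?thesis using elim by simp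
    next
      case False
      have "4 * c \<le> r k ^ 3 / a * \<delta>" using elim by simp
      also have "\<dots> \<le> norm (y k)"
        unfolding ny using \<delta>[OF False] a0 elim by (intro mult_left_mono) auto
      finally have "4 * c \<le> norm (y k)" .
      moreover have "norm (y k) \<le> norm (z k + y k) + norm (z k)"
        using norm_triangle_ineq4[of "z k + y k" "z k"] by simp
      ultimately show ?thesis using elim c0 by linarith
    qed
    then have lower: "1 / 2 \<le> norm (z k + y k) / c" using c0 by (simp add: field_simps)
    have "r k ^ 3 \<le> r k ^ 4" using elim by (intro power_increasing) auto
    also have "r k ^ 4 = ((r k)\<^sup>2)\<^sup>2" by simp
    also have "(r k)\<^sup>2 = pi * a / 2 * real k" using a0 by (simp add: r_def)
    also have "\<dots>\<^sup>2 = (pi * a / 2)\<^sup>2 * (real k)\<^sup>2" by (rule power_mult_distrib)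
    finally have r3: "r k ^ 3 \<le> (pi * a / 2)\<^sup>2 * (real k)\<^sup>2" .
    have "norm (y k) \<le> (pi * a / 2)\<^sup>2 * (real k)\<^sup>2 / a * D"
      unfolding ny using r3 D[of k] D0 a0 elim by (intro mult_mono divide_right_mono) auto
    also have "\<dots> = (B - 1) * c * (real k)\<^sup>2" using c0 by (simp add: B_def)
    also have "\<dots> \<le> B * c * (real k)\<^sup>2" using c0 by (intro mult_right_mono) auto
    finally have "norm (z k + y k) \<le> 2 * c + B * c * (real k)\<^sup>2"
      using norm_triangle_ineq[of "z k" "y k"] elim by linarith
    then have "norm (z k + y k) / c \<le> 2 + B * (real k)\<^sup>2" using c0 by (simp add: field_simps)
    with lower show ?case using spec[of k] elim by simp
  qed
  with B0 show ?thesis by (rule that)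
qed

theorem mainTheorem2:
  fixes m p :: nat
  assumes "m > 0" and "p > 0" and "coprime m p"
  shows "(\<forall>k\<ge>1. (jones_ratio m p k \<longlongrightarrow> hyperbolic_spec m p k) (at (spec_point k))) \<and>
         (\<forall>\<^sub>F k in sequentially. hyperbolic_spec m p k \<noteq> 0) \<and>
         (\<lambda>k. ln (cmod (hyperbolic_spec m p k)) / real k) \<longlonglongrightarrow> 0"
proof (intro conjI allI impI)
  fix k :: nat assume "1 \<le> k"
  then show "(jones_ratio m p k \<longlongrightarrow> hyperbolic_spec m p k) (at (spec_point k))"
    by (intro hyperbolic_spec_limit(1) assms) simp
next
  obtain B where B: "B > 0" and bnd: "\<forall>\<^sub>F k in sequentially. 1 / 2 \<le> norm (hyperbolic_spec m p k) \<and> norm (hyperbolic_spec m p k) \<le> 2 + B * (real k)\<^sup>2"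
    using hyperbolic_spec_bounds[OF assms] .
  show "\<forall>\<^sub>F k in sequentially. hyperbolic_spec m p k \<noteq> 0"
    using bnd by eventually_elim auto
  show "(\<lambda>k. ln (cmod (hyperbolic_spec m p k)) / real k) \<longlonglongrightarrow> 0"
  proof (rule tendsto_sandwich)
    show "\<forall>\<^sub>F k in sequentially. ln (1 / 2) / real k \<le> ln (cmod (hyperbolic_spec m p k)) / real k"
      using bnd by eventually_elim (intro divide_right_mono ln_mono, auto)
    show "\<forall>\<^sub>F k in sequentially. ln (cmod (hyperbolic_spec m p k)) / real k \<le> ln (2 + B * (real k)\<^sup>2) / real k"
      using bnd by eventually_elim (intro divide_right_mono ln_mono, auto)
    show "(\<lambda>k. ln (1 / 2) / real k) \<longlonglongrightarrow> 0" by real_asymp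
    show "(\<lambda>k. ln (2 + B * (real k)\<^sup>2) / real k) \<longlonglongrightarrow> 0" using B by real_asymp
  qed
qed

end
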